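(* Let $\mathcal{X}\subseteq\mathbb{R}$ be a connected set with nonempty interior, let $\alpha>0$, $\sigma>0$, $\varepsilon>0$, and let $f:\mathcal{X}\to\mathbb{R}$ be a Lebesgue measurable function with $0\in\mathcal X$, $f(0)=0$, $f(x)<0$ for all $x\in\mathcal{X}\setminus\{0\}$, $\int_{\mathcal{X}}\frac{1}{|f(x)+p|}\,\mathrm{d}x<+\infty$ for every $p<0$, and $f(x)=-|x|^{\alpha}$ for all $x\in\mathcal X$ in a neighbourhood of $0$ which contains $[0,\varepsilon]$, where $[0,\varepsilon]\subseteq\mathcal{X}$. Let $Q=\operatorname{I}$ be the identity on $L^2(\mathcal{X})$, and for $p<0$ let $V_\infty$ be the time-asymptotic covariance operator of the solution of $\mathrm{d}u(x,t)=(f(x)+p)\,u(x,t)\,\mathrm{d}t+\sigma\,\mathrm{d}W(t)$. Let $g=\mathbbm{1}_{[0,\varepsilon]}$. Then, as $p\to0^-$: (i) if $0<\alpha<1$, then $\langle V_\infty g,g\rangle=\Theta(1)$; (ii) if $\alpha=1$, then $\langle V_\infty g,g\rangle=\Theta(-\log(-p))$; (iii) if $\alpha>1$, then $\langle V_\infty g,g\rangle=\Theta\big((-p)^{-1+\frac1\alpha}\big)$; and in the limit $\alpha\to\infty$ the scaling law in (iii) becomes $(-p)^{-1}$, i.e. the exponent $-1+\frac1\alpha$ tends to $-1$.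
   Context: $L^2(\mathcal{X})$ is the real Hilbert space of square-integrable functions with usual scalar product $\langle\cdot,\cdot\rangle$, and $\mathbbm{1}_S$ is the indicator function of $S$. $\operatorname{T}_{h}$ denotes the multiplication operator $u\mapsto hu$ in $L^2(\mathcal{X})$. $W$ is a (generalized) $Q$-Wiener process with covariance operator $Q$. The covariance operator at time $t>0$ of the mild solution of the stochastic equation is $$V(t):=\sigma^2\int_0^t e^{\operatorname{T}_{f+p}s}\,Q\,e^{\operatorname{T}_{f+p}s}\,\mathrm{d}s,$$ and the time-asymptotic covariance operator is $V_\infty:=\lim_{t\to\infty}V(t)$ (it depends on $p<0$). Notation $\Theta$: for functions $b_1,b_2$ of $p<0$ that are positive for $p$ near $0$, $b_1=\Theta(b_2)$ as $p\to0^-$ means $\lim_{p\to0^-}\frac{b_1(p)}{b_2(p)}>0$ and $\lim_{p\to0^-}\frac{b_2(p)}{b_1(p)}>0$. *)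

theory Defs
  imports "HOL-Analysis.Analysis"
begin

definition sq_integrable :: "(real \<Rightarrow> real) \<Rightarrow> bool" where
  "sq_integrable u \<longleftrightarrow> u \<in> borel_measurable lebesgue \<and> integrable lebesgue (\<lambda>x. (u x)\<^sup>2)"

lemma sq_integrableD [measurable_dest]: "sq_integrable u \<Longrightarrow> u \<in> borel_measurable lebesgue"
  by (simp add: sq_integrable_def)

lemma sq_integrable_mult:
  assumes u: "sq_integrable u" and v: "sq_integrable v"
  shows "integrable lebesgue (\<lambda>x. u x * v x)"
proof (rule Bochner_Integration.integrable_bound)
  show "integrable lebesgue (\<lambda>x. (u x)\<^sup>2 + (v x)\<^sup>2)"
    using u v by (auto simp: sq_integrable_def)
  show "(\<lambda>x. u x * v x) \<in> borel_measurable lebesgue"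
    using u v by (auto simp: sq_integrable_def)
  have "\<bar>a * b\<bar> \<le> a\<^sup>2 + b\<^sup>2" for a b :: real
  proof -
    have "0 \<le> (\<bar>a\<bar> - \<bar>b\<bar>)\<^sup>2" by simp
    hence "2 * (\<bar>a\<bar> * \<bar>b\<bar>) \<le> a\<^sup>2 + b\<^sup>2" by (simp add: power2_diff)
    moreover have "0 \<le> a\<^sup>2 + b\<^sup>2" by simp
    ultimately show ?thesis unfolding abs_mult by linarith
  qed
  thus "AE x in lebesgue. norm (u x * v x) \<le> norm ((u x)\<^sup>2 + (v x)\<^sup>2)"
    by simp
qed

lemma sq_integrable_add:
  assumes u: "sq_integrable u" and v: "sq_integrable v"
  shows "sq_integrable (\<lambda>x. u x + v x)"
  using u v sq_integrable_mult[OF u v]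
  by (auto simp: sq_integrable_def power2_sum mult.assoc)

lemma sq_integrable_scale: "sq_integrable u \<Longrightarrow> sq_integrable (\<lambda>x. c * u x)"
  by (auto simp: sq_integrable_def power_mult_distrib)

lemma sq_integrable_zero: "sq_integrable (\<lambda>x. 0)"
  by (simp add: sq_integrable_def)

definition l2_rel :: "(real \<Rightarrow> real) \<Rightarrow> (real \<Rightarrow> real) \<Rightarrow> bool" where
  "l2_rel u v \<longleftrightarrow> sq_integrable u \<and> sq_integrable v \<and> (AE x in lebesgue. u x = v x)"

quotient_type L2 = "real \<Rightarrow> real" / partial: l2_rel
proof (rule part_equivpI)
  show "\<exists>u. l2_rel u u"
    by (rule exI[of _ "\<lambda>x. 0"]) (simp add: l2_rel_def sq_integrable_zero)
  show "symp l2_rel"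
    by (auto simp: symp_def l2_rel_def eq_commute)
  show "transp l2_rel"
  proof (rule transpI)
    fix u v w assume "l2_rel u v" "l2_rel v w"
    moreover from this have "AE x in lebesgue. u x = v x" "AE x in lebesgue. v x = w x"
      by (simp_all add: l2_rel_def)
    hence "AE x in lebesgue. u x = w x" by eventually_elim simp
    ultimately show "l2_rel u w" by (simp add: l2_rel_def)
  qed
qed

instantiation L2 :: real_vector
begin

lift_definition zero_L2 :: L2 is "\<lambda>x. 0"
  by (simp add: l2_rel_def sq_integrable_zero)

lift_definition plus_L2 :: "L2 \<Rightarrow> L2 \<Rightarrow> L2" is "\<lambda>u v x. u x + v x"
proof -
  fix u u' v v' assume "l2_rel u u'" "l2_rel v v'"
  moreover from this have "AE x in lebesgue. u x = u' x" "AE x in lebesgue. v x = v' x"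
    by (simp_all add: l2_rel_def)
  hence "AE x in lebesgue. u x + v x = u' x + v' x" by eventually_elim simp
  ultimately show "l2_rel (\<lambda>x. u x + v x) (\<lambda>x. u' x + v' x)"
    by (simp add: l2_rel_def sq_integrable_add)
qed

lift_definition scaleR_L2 :: "real \<Rightarrow> L2 \<Rightarrow> L2" is "\<lambda>c u x. c * u x"
  by (auto simp: l2_rel_def sq_integrable_scale elim: AE_mp)

definition uminus_L2 :: "L2 \<Rightarrow> L2" where "uminus_L2 u = (-1) *\<^sub>R u"

definition minus_L2 :: "L2 \<Rightarrow> L2 \<Rightarrow> L2" where "minus_L2 u v = u + (-1) *\<^sub>R v"

instance
proof
  fix a b :: real and u v w :: L2
  show "u + v + w = u + (v + w)"
    by transfer (auto simp: l2_rel_def algebra_simps intro!: sq_integrable_add)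
  show "u + v = v + u"
    by transfer (auto simp: l2_rel_def algebra_simps intro!: sq_integrable_add)
  show "0 + u = u"
    by transfer (auto simp: l2_rel_def)
  show "- u + u = 0"
    unfolding uminus_L2_def
    by transfer (auto simp: l2_rel_def sq_integrable_zero)
  show "u - v = u + - v"
    by (simp add: uminus_L2_def minus_L2_def)
  show "a *\<^sub>R (u + v) = a *\<^sub>R u + a *\<^sub>R v"
    by transfer (auto simp: l2_rel_def algebra_simps intro!: sq_integrable_add sq_integrable_scale)
  show "(a + b) *\<^sub>R u = a *\<^sub>R u + b *\<^sub>R u"
    by transfer (auto simp: l2_rel_def distrib_right intro!: sq_integrable_add sq_integrable_scale)
  show "a *\<^sub>R b *\<^sub>R u = (a * b) *\<^sub>R u"
    by transfer (auto simp: l2_rel_def mult.assoc intro!: sq_integrable_scale)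
  show "1 *\<^sub>R u = u"
    by transfer (auto simp: l2_rel_def)
qed

end

instantiation L2 :: real_inner
begin

lift_definition inner_L2 :: "L2 \<Rightarrow> L2 \<Rightarrow> real" is "\<lambda>u v. \<integral>x. u x * v x \<partial>lebesgue"
proof (rule integral_cong_AE)
  fix u u' v v' assume uv: "l2_rel u u'" "l2_rel v v'"
  show "(\<lambda>x. u x * v x) \<in> borel_measurable lebesgue"
    "(\<lambda>x. u' x * v' x) \<in> borel_measurable lebesgue"
    using uv by (auto simp: l2_rel_def sq_integrable_def)
  have "AE x in lebesgue. u x = u' x" "AE x in lebesgue. v x = v' x"
    using uv by (simp_all add: l2_rel_def)
  thus "AE x in lebesgue. u x * v x = u' x * v' x" by eventually_elim simp
qed

definition norm_L2 :: "L2 \<Rightarrow> real" where "norm_L2 u = sqrt (inner u u)"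

definition dist_L2 :: "L2 \<Rightarrow> L2 \<Rightarrow> real" where "dist_L2 u v = norm (u - v)"

definition sgn_L2 :: "L2 \<Rightarrow> L2" where "sgn_L2 u = u /\<^sub>R norm u"

definition uniformity_L2 :: "(L2 \<times> L2) filter" where
  "uniformity_L2 = (INF e\<in>{0<..}. principal {(u, v). dist u v < e})"

definition open_L2 :: "L2 set \<Rightarrow> bool" where
  "open_L2 U \<longleftrightarrow> (\<forall>u\<in>U. \<forall>\<^sub>F (u', v) in uniformity. u' = u \<longrightarrow> v \<in> U)"

instance
proof
  fix r :: real and u v w :: L2 and U :: "L2 set"
  show "dist u v = norm (u - v)" by (rule dist_L2_def)
  show "sgn u = u /\<^sub>R norm u" by (rule sgn_L2_def)
  show "uniformity = (INF e\<in>{0<..}. principal {(x::L2, y). dist x y < e})"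
    by (rule uniformity_L2_def)
  show "open U = (\<forall>x\<in>U. \<forall>\<^sub>F (x', y) in uniformity. x' = x \<longrightarrow> y \<in> U)"
    by (rule open_L2_def)
  show "norm u = sqrt (inner u u)" by (rule norm_L2_def)
  show "inner u v = inner v u"
    by transfer (simp add: mult.commute)
  show "inner (u + v) w = inner u w + inner v w"
    by transfer (simp add: l2_rel_def distrib_right sq_integrable_mult)
  show "inner (r *\<^sub>R u) v = r * inner u v"
    by transfer (simp add: mult.assoc)
  show "0 \<le> inner u u"
    by transfer simp
  show "inner u u = 0 \<longleftrightarrow> u = 0"
    by transfer
      (auto simp: l2_rel_def sq_integrable_zero sq_integrable_mult integral_nonneg_eq_0_iff_AE)
qed

end

instance L2 :: banach
proof
  fix X :: "nat \<Rightarrow> L2"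
  assume X: "Cauchy X"
  define U where "U n = rep_L2 (X n)" for n
  have U_rel: "l2_rel (U n) (U n)" for n
    unfolding U_def by (rule Quotient3_rep_reflp[OF Quotient3_L2])
  have X_U: "X n = abs_L2 (U n)" for n
    unfolding U_def by (simp add: Quotient3_abs_rep[OF Quotient3_L2])
  have U_sq: "sq_integrable (U n)" for n
    using U_rel by (simp add: l2_rel_def)
  have U_meas [measurable]: "U n \<in> borel_measurable lebesgue" for n
    using U_sq by (rule sq_integrableD)
  have diff_abs: "abs_L2 u - abs_L2 v = abs_L2 (\<lambda>x. u x - v x)"
    if "sq_integrable u" "sq_integrable v" for u v
  proof -
    have "abs_L2 u - abs_L2 v = abs_L2 u + abs_L2 (\<lambda>x. (-1) * v x)"
      unfolding minus_L2_def
      by (rule arg_cong[OF scaleR_L2.abs_eq]) (simp add: l2_rel_def that)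
    also have "\<dots> = abs_L2 (\<lambda>x. u x + (-1) * v x)"
      by (rule plus_L2.abs_eq) (use that sq_integrable_scale[OF that(2), of "-1"] in \<open>simp_all add: l2_rel_def\<close>)
    finally show ?thesis by simp
  qed
  have sq_diff: "sq_integrable (\<lambda>x. u x - v x)" if "sq_integrable u" "sq_integrable v" for u v
    using sq_integrable_add[OF that(1) sq_integrable_scale[OF that(2), of "-1"]] by simp
  have norm_abs: "ennreal ((norm (abs_L2 u))\<^sup>2) = (\<integral>\<^sup>+x. ennreal ((u x)\<^sup>2) \<partial>lebesgue)"
    if "sq_integrable u" for u
  proof -
    have "(norm (abs_L2 u))\<^sup>2 = (\<integral>x. (u x)\<^sup>2 \<partial>lebesgue)"
      using that
      by (simp add: power2_norm_eq_inner inner_L2.abs_eq l2_rel_def)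
        (simp add: power2_eq_square)
    thus ?thesis
      using that by (simp add: sq_integrable_def nn_integral_eq_integral)
  qed
  have dist_U: "ennreal ((dist (X m) (X n))\<^sup>2) = (\<integral>\<^sup>+x. ennreal ((U m x - U n x)\<^sup>2) \<partial>lebesgue)" for m n
    by (simp add: dist_norm X_U diff_abs U_sq sq_diff norm_abs)
  have "\<exists>N. \<forall>m\<ge>N. \<forall>n\<ge>N. dist (X m) (X n) < (1/2)^k" for k :: nat
    using X unfolding Cauchy_def by simp
  then obtain N where N: "dist (X m) (X n) < (1/2)^k" if "m \<ge> N k" "n \<ge> N k" for k m n
    by metis
  define r where "r = rec_nat (N 0) (\<lambda>k s. max (Suc s) (N (Suc k)))"
  have r_Suc: "r (Suc k) = max (Suc (r k)) (N (Suc k))" for k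
    by (simp add: r_def)
  have r_mono: "strict_mono r"
    by (rule strict_monoI_Suc) (simp add: r_Suc)
  have r_N: "N k \<le> r k" for k
    by (cases k) (simp_all add: r_def)
  define d where "d n x = U (r (Suc n)) x - U (r n) x" for n x
  have d_meas [measurable]: "d n \<in> borel_measurable lebesgue" for n
    unfolding d_def[abs_def] by (intro borel_measurable_diff U_meas)
  have d_le: "(\<integral>\<^sup>+x. ennreal (2^n * (d n x)\<^sup>2) \<partial>lebesgue) \<le> ennreal ((1/2)^n)" for n
  proof -
    have "dist (X (r (Suc n))) (X (r n)) < (1/2)^n"
      using r_N[of n] strict_mono_less_eq[OF r_mono, of n "Suc n"] by (intro N) auto
    hence "(dist (X (r (Suc n))) (X (r n)))\<^sup>2 \<le> ((1/2)^n)\<^sup>2"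
      by (intro power_mono) auto
    hence le: "2^n * (dist (X (r (Suc n))) (X (r n)))\<^sup>2 \<le> 2^n * ((1/2)^n)\<^sup>2"
      by (intro mult_left_mono) auto
    have "(\<integral>\<^sup>+x. ennreal (2^n * (d n x)\<^sup>2) \<partial>lebesgue)
        = (\<integral>\<^sup>+x. ennreal (2^n) * ennreal ((d n x)\<^sup>2) \<partial>lebesgue)"
      by (simp add: ennreal_mult)
    also have "\<dots> = ennreal (2^n) * ennreal ((dist (X (r (Suc n))) (X (r n)))\<^sup>2)"
      unfolding dist_U d_def by (rule nn_integral_cmult) measurable
    also have "\<dots> = ennreal (2^n * (dist (X (r (Suc n))) (X (r n)))\<^sup>2)"
      by (simp add: ennreal_mult)
    also have "\<dots> \<le> ennreal (2^n * ((1/2)^n)\<^sup>2)"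
      using le by (rule ennreal_leI)
    also have "(2::real)^n * ((1/2)^n)\<^sup>2 = (1/2)^n"
      by (simp add: power2_eq_square power_divide)
    finally show ?thesis .
  qed
  have "(\<integral>\<^sup>+x. (\<Sum>n. ennreal (2^n * (d n x)\<^sup>2)) \<partial>lebesgue)
      = (\<Sum>n. \<integral>\<^sup>+x. ennreal (2^n * (d n x)\<^sup>2) \<partial>lebesgue)"
    by (rule nn_integral_suminf) measurable
  also have "\<dots> \<le> (\<Sum>n. ennreal ((1/2)^n))"
    by (intro suminf_le d_le) auto
  also have "\<dots> = ennreal (\<Sum>n. (1/2)^n)"
    by (rule suminf_ennreal2) (auto intro: summable_geometric)
  finally have "(\<integral>\<^sup>+x. (\<Sum>n. ennreal (2^n * (d n x)\<^sup>2)) \<partial>lebesgue) \<noteq> \<infinity>"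
    using le_less_trans[OF _ ennreal_less_top] by fastforce
  hence "AE x in lebesgue. (\<Sum>n. ennreal (2^n * (d n x)\<^sup>2)) \<noteq> \<infinity>"
    by (intro nn_integral_PInf_AE) measurable
  hence conv: "AE x in lebesgue. convergent (\<lambda>n. U (r n) x)"
  proof eventually_elim
    case (elim x)
    define C where "C = enn2real (\<Sum>n. ennreal (2^n * (d n x)\<^sup>2))"
    have C: "(\<Sum>n. ennreal (2^n * (d n x)\<^sup>2)) = ennreal C" "C \<ge> 0"
      using elim unfolding C_def by (simp_all only: ennreal_enn2real less_top infinity_ennreal_def enn2real_nonneg)
    have d_bound: "norm (d n x) \<le> sqrt C * (sqrt (1/2))^n" for n
    proof -
      have "ennreal (2^n * (d n x)\<^sup>2) = (\<Sum>i\<in>{n}. ennreal (2^i * (d i x)\<^sup>2))" by simp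
      also have "\<dots> \<le> (\<Sum>n. ennreal (2^n * (d n x)\<^sup>2))"
        by (rule sum_le_suminf) auto
      also have "\<dots> = ennreal C" by (rule C(1))
      finally have "2^n * (d n x)\<^sup>2 \<le> C"
        using C(2) by (simp only: ennreal_le_iff)
      hence "(d n x)\<^sup>2 \<le> C * (1/2)^n"
        by (simp add: power_one_over field_simps)
      hence "sqrt ((d n x)\<^sup>2) \<le> sqrt (C * (1/2)^n)"
        by (rule real_sqrt_le_mono)
      moreover have "sqrt (C * (1/2)^n) = sqrt C * (sqrt (1/2))^n"
        by (simp only: real_sqrt_mult real_sqrt_power)
      ultimately show ?thesis by (simp only: real_sqrt_abs real_norm_def)
    qed
    have "summable (\<lambda>n. sqrt C * (sqrt (1/2))^n)"
      by (intro summable_mult summable_geometric) simp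
    hence "summable (\<lambda>n. d n x)"
      by (rule summable_comparison_test') (rule d_bound)
    hence "convergent (\<lambda>n. \<Sum>i<n. d i x)"
      by (simp add: summable_iff_convergent)
    moreover have "(\<Sum>i<n. d i x) = U (r n) x - U (r 0) x" for n
      unfolding d_def by (rule sum_lessThan_telescope)
    ultimately have "convergent (\<lambda>n. (U (r n) x - U (r 0) x) + U (r 0) x)"
      by (intro convergent_add convergent_const) simp
    thus ?case by simp
  qed
  define v where "v x = lim (\<lambda>n. U (r n) x)" for x
  have v_meas [measurable]: "v \<in> borel_measurable lebesgue"
    unfolding v_def[abs_def] by (intro borel_measurable_lim_metric U_meas)
  have v_lim: "AE x in lebesgue. (\<lambda>n. U (r n) x) \<longlonglongrightarrow> v x"
    using conv by eventually_elim (simp add: v_def convergent_LIMSEQ_iff)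
  have fatou: "(\<integral>\<^sup>+x. ennreal ((v x - U m x)\<^sup>2) \<partial>lebesgue) \<le> ennreal (e\<^sup>2)"
    if m: "\<And>n. n \<ge> M \<Longrightarrow> dist (X n) (X m) < e" for m M e
  proof -
    have "(\<integral>\<^sup>+x. ennreal ((v x - U m x)\<^sup>2) \<partial>lebesgue)
        = (\<integral>\<^sup>+x. liminf (\<lambda>n. ennreal ((U (r n) x - U m x)\<^sup>2)) \<partial>lebesgue)"
    proof (rule nn_integral_cong_AE)
      show "AE x in lebesgue. ennreal ((v x - U m x)\<^sup>2)
          = liminf (\<lambda>n. ennreal ((U (r n) x - U m x)\<^sup>2))"
        using v_lim
      proof eventually_elim
        case (elim x)
        have "(\<lambda>n. ennreal ((U (r n) x - U m x)\<^sup>2)) \<longlonglongrightarrow> ennreal ((v x - U m x)\<^sup>2)"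
          by (intro tendsto_intros elim)
        thus ?case by (intro lim_imp_Liminf[symmetric]) simp_all
      qed
    qed
    also have "\<dots> \<le> liminf (\<lambda>n. \<integral>\<^sup>+x. ennreal ((U (r n) x - U m x)\<^sup>2) \<partial>lebesgue)"
      by (rule nn_integral_liminf) measurable
    also have "\<dots> \<le> limsup (\<lambda>n. \<integral>\<^sup>+x. ennreal ((U (r n) x - U m x)\<^sup>2) \<partial>lebesgue)"
      by (rule Liminf_le_Limsup) simp
    also have "\<dots> \<le> ennreal (e\<^sup>2)"
    proof (rule Limsup_bounded)
      show "\<forall>\<^sub>F n in sequentially. (\<integral>\<^sup>+x. ennreal ((U (r n) x - U m x)\<^sup>2) \<partial>lebesgue) \<le> ennreal (e\<^sup>2)"
        using eventually_ge_at_top[of M]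
      proof eventually_elim
        case (elim n)
        hence "M \<le> r n" using seq_suble[OF r_mono, of n] by linarith
        hence "(dist (X (r n)) (X m))\<^sup>2 \<le> e\<^sup>2"
          using m[of "r n"] by (intro power_mono) auto
        thus ?case unfolding dist_U[symmetric] by (rule ennreal_leI)
      qed
    qed
    finally show ?thesis .
  qed
  have sq_vU: "sq_integrable (\<lambda>x. v x - U m x)"
    if m: "\<And>n. n \<ge> M \<Longrightarrow> dist (X n) (X m) < e" for m M e
  proof -
    have "(\<integral>\<^sup>+x. ennreal ((v x - U m x)\<^sup>2) \<partial>lebesgue) < \<infinity>"
      using fatou[OF m] le_less_trans[OF _ ennreal_less_top] by fastforce
    thus ?thesis
      unfolding sq_integrable_def by (auto simp: integrable_iff_bounded)
  qed
  have v_sq: "sq_integrable v"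
  proof -
    have "sq_integrable (\<lambda>x. (v x - U (N 0) x) + U (N 0) x)"
      by (rule sq_integrable_add[OF sq_vU[where m="N 0" and M="N 0" and e=1] U_sq])
        (use N[of 0] in auto)
    thus ?thesis by simp
  qed
  have "X \<longlonglongrightarrow> abs_L2 v"
  proof (rule metric_LIMSEQ_I)
    fix e :: real assume e: "0 < e"
    obtain M where M: "\<And>m n. m \<ge> M \<Longrightarrow> n \<ge> M \<Longrightarrow> dist (X m) (X n) < e/2"
      using X e unfolding Cauchy_def by (meson half_gt_zero)
    have "dist (X m) (abs_L2 v) < e" if m: "m \<ge> M" for m
    proof -
      have "ennreal ((norm (abs_L2 v - X m))\<^sup>2) \<le> ennreal ((e/2)\<^sup>2)"
        using fatou[where m=m and M=M and e="e/2"] M m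
        by (simp add: X_U diff_abs U_sq v_sq norm_abs sq_diff)
      hence "(norm (abs_L2 v - X m))\<^sup>2 \<le> (e/2)\<^sup>2"
        by simp
      hence "norm (abs_L2 v - X m) \<le> e/2"
        by (rule power2_le_imp_le) (use e in simp)
      thus ?thesis using e by (simp add: dist_norm norm_minus_commute)
    qed
    thus "\<exists>M. \<forall>m\<ge>M. dist (X m) (abs_L2 v) < e" by blast
  qed
  thus "convergent X" by (rule convergentI)
qed


text \<open>
  \<^term>\<open>L2\<close> is the space over the whole line; the space over \<open>X\<close> is its closed subspace of classes
  vanishing almost everywhere off \<open>X\<close>, with the inherited inner product.  Operators on that
  subspace are functions whose values off it are irrelevant.
\<close>

definition L2_on :: "real set \<Rightarrow> L2 set" where
  "L2_on X = {u. AE x in lebesgue. x \<notin> X \<longrightarrow> rep_L2 u x = 0}"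

text \<open>Unbounded operators are given by their graphs.  The multiplication operator has its maximal
  domain, consisting of those \<open>u\<close> for which \<open>h u\<close> is again square-integrable.\<close>

definition mult_op :: "real set \<Rightarrow> (real \<Rightarrow> real) \<Rightarrow> (L2 \<times> L2) set" where
  "mult_op X h = {(u, w). u \<in> L2_on X \<and> w \<in> L2_on X \<and>
     (AE x in lebesgue. x \<in> X \<longrightarrow> rep_L2 w x = h x * rep_L2 u x)}"

definition bounded_operator_on :: "'a::real_normed_vector set \<Rightarrow> ('a \<Rightarrow> 'a) \<Rightarrow> bool" where
  "bounded_operator_on H T \<longleftrightarrow>
     (\<forall>u\<in>H. T u \<in> H) \<and>
     (\<forall>u\<in>H. \<forall>v\<in>H. T (u + v) = T u + T v) \<and>
     (\<forall>c. \<forall>u\<in>H. T (c *\<^sub>R u) = c *\<^sub>R T u) \<and>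
     (\<exists>K. \<forall>u\<in>H. norm (T u) \<le> K * norm u)"

definition c0_semigroup_on :: "'a::real_normed_vector set \<Rightarrow> (real \<Rightarrow> 'a \<Rightarrow> 'a) \<Rightarrow> bool" where
  "c0_semigroup_on H S \<longleftrightarrow>
     (\<forall>s\<ge>0. bounded_operator_on H (S s)) \<and>
     (\<forall>u\<in>H. S 0 u = u) \<and>
     (\<forall>s\<ge>0. \<forall>t\<ge>0. \<forall>u\<in>H. S (s + t) u = S s (S t u)) \<and>
     (\<forall>u\<in>H. ((\<lambda>s. S s u) \<longlongrightarrow> u) (at_right 0))"

definition generator_on ::
  "'a::real_normed_vector set \<Rightarrow> (real \<Rightarrow> 'a \<Rightarrow> 'a) \<Rightarrow> ('a \<times> 'a) set" where
  "generator_on H S =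
     {(u, w). u \<in> H \<and> w \<in> H \<and> ((\<lambda>s. (S s u - u) /\<^sub>R s) \<longlongrightarrow> w) (at_right 0)}"

text \<open>\<open>op_exp H A s\<close> is \<open>e\<^bsup>A s\<^esup>\<close>, the strongly continuous semigroup on \<open>H\<close> generated by \<open>A\<close>;
  on \<open>H\<close> and for \<open>s \<ge> 0\<close> it is determined by \<open>A\<close>.\<close>

definition op_exp ::
  "'a::real_normed_vector set \<Rightarrow> ('a \<times> 'a) set \<Rightarrow> real \<Rightarrow> 'a \<Rightarrow> 'a" where
  "op_exp H A = (SOME S. c0_semigroup_on H S \<and> generator_on H S = A)"

text \<open>The operator-valued integral and the limit in time are taken in the strong sense, that is,
  after application to a fixed \<open>u\<close>.\<close>

definition covariance_op ::
  "real set \<Rightarrow> (real \<Rightarrow> real) \<Rightarrow> real \<Rightarrow> (L2 \<Rightarrow> L2) \<Rightarrow> real \<Rightarrow> real \<Rightarrow> L2 \<Rightarrow> L2" where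
  "covariance_op X f \<sigma> Q p t u =
     (let E = op_exp (L2_on X) (mult_op X (\<lambda>x. f x + p))
      in \<sigma>\<^sup>2 *\<^sub>R integral {0..t} (\<lambda>s. E s (Q (E s u))))"

definition asymptotic_covariance_op ::
  "real set \<Rightarrow> (real \<Rightarrow> real) \<Rightarrow> real \<Rightarrow> (L2 \<Rightarrow> L2) \<Rightarrow> real \<Rightarrow> L2 \<Rightarrow> L2" where
  "asymptotic_covariance_op X f \<sigma> Q p u = Lim at_top (\<lambda>t. covariance_op X f \<sigma> Q p t u)"

text \<open>Meaningful for measurable \<open>S\<close> of finite measure; \<^term>\<open>abs_L2\<close> is unspecified on functions that
  are not square-integrable.\<close>

definition l2_indicator :: "real set \<Rightarrow> L2" where
  "l2_indicator S = abs_L2 (indicator S)"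

text \<open>Real limits suffice: if one quotient tended to infinity, the other would tend to \<open>0\<close>.\<close>

definition is_Theta_at_0_minus :: "(real \<Rightarrow> real) \<Rightarrow> (real \<Rightarrow> real) \<Rightarrow> bool" where
  "is_Theta_at_0_minus b1 b2 \<longleftrightarrow>
     (\<forall>\<^sub>F p in at_left 0. b1 p > 0) \<and> (\<forall>\<^sub>F p in at_left 0. b2 p > 0) \<and>
     (\<exists>L>0. ((\<lambda>p. b1 p / b2 p) \<longlongrightarrow> L) (at_left 0)) \<and>
     (\<exists>L>0. ((\<lambda>p. b2 p / b1 p) \<longlongrightarrow> L) (at_left 0))"

end

theory Submission
  imports Defs
begin

text \<open>
  For white noise the two exponentials in the integrand of \<open>V(t)\<close> merge into \<open>e\<^bsup>2As\<^esup>\<close>, where \<open>A\<close> is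
  multiplication by \<open>f + p\<close>.  If \<open>A w = g\<close>, then \<open>e\<^bsup>2As\<^esup> g\<close> is the derivative of \<open>(1/2) e\<^bsup>2As\<^esup> w\<close>, so
  \<open>V(t) g = (\<sigma>\<^sup>2/2) (e\<^bsup>2At\<^esup> w - w)\<close>, which tends to \<open>-(\<sigma>\<^sup>2/2) w\<close> because \<open>f + p \<le> p < 0\<close> makes the
  semigroup decay.  For the indicator \<open>g\<close> of \<open>[0, \<epsilon>]\<close> the preimage is \<open>w = g / (f + p)\<close>, hence
  \<open>\<langle>V\<^sub>\<infinity> g, g\<rangle> = (\<sigma>\<^sup>2/2) \<integral>\<^sub>0\<^sup>\<epsilon> dx / (x\<^sup>\<alpha> + q)\<close> with \<open>q = -p\<close>
  (\<open>asymptotic_covariance_indicator\<close>).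

  The exponential is an arbitrary choice among the strongly continuous semigroups with generator
  \<open>A\<close>, so two things have to be known about it.  First, such a semigroup exists: pointwise
  multiplication by \<open>e\<^bsup>s(f + p)\<^esup>\<close> is one, and its generator is \<open>A\<close> with exactly the maximal domain
  (\<open>mult_op_subset_generator\<close>, \<open>generator_subset_mult_op\<close>).  Second, the argument above must work
  for every such semigroup, and it does, since it only involves the generator and orbits of vectors
  in its domain.  Differentiability of these orbits from the left rests on local
  boundedness of the semigroup, that is, on the uniform boundedness principle
  (\<open>uniform_boundedness_on\<close>); their decay follows from \<open>\<langle>A u, u\<rangle> \<le> p \<parallel>u\<parallel>\<^sup>2\<close>
  (\<open>dissipative_semigroup_decay\<close>).

  What remains is the integral \<open>\<integral>\<^sub>0\<^sup>\<epsilon> dx / (x\<^sup>\<alpha> + q)\<close> as \<open>q \<rightarrow> 0\<^sup>+\<close>.  It is monotone in \<open>q\<close>.  For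
  \<open>\<alpha> < 1\<close> it is bounded by the convergent integral of \<open>x\<^bsup>-\<alpha>\<^esup>\<close> and so has a positive limit.  For \<open>\<alpha> = 1\<close>
  it is \<open>ln (\<epsilon> + q) - ln q\<close>.  For \<open>\<alpha> > 1\<close> the substitution \<open>x = q\<^bsup>1/\<alpha>\<^esup> y\<close> extracts the factor
  \<open>q\<^bsup>-1 + 1/\<alpha>\<^esup>\<close> and leaves an integral of \<open>1 / (y\<^sup>\<alpha> + 1)\<close> over a growing interval, which converges.
\<close>

section \<open>Square-integrable functions and their classes\<close>

lemma sq_integrable_rep_L2: "sq_integrable (rep_L2 u)"
  using Quotient3_rep_reflp[OF Quotient3_L2, of u] by (simp add: l2_rel_def)

lemma rep_L2_measurable [measurable]: "rep_L2 u \<in> borel_measurable lebesgue"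
  by (rule sq_integrableD[OF sq_integrable_rep_L2])

lemma rep_abs_L2_AE:
  assumes "sq_integrable \<phi>"
  shows "AE x in lebesgue. rep_L2 (abs_L2 \<phi>) x = \<phi> x"
proof -
  have "l2_rel \<phi> \<phi>" using assms by (simp add: l2_rel_def)
  then have "l2_rel (rep_L2 (abs_L2 \<phi>)) \<phi>"
    by (rule rep_abs_rsp_left[OF Quotient3_L2])
  then show ?thesis by (simp add: l2_rel_def)
qed

lemma abs_rep_L2: "abs_L2 (rep_L2 u) = u"
  by (rule Quotient3_abs_rep[OF Quotient3_L2])

lemma abs_L2_cong_AE:
  assumes "sq_integrable \<phi>" "sq_integrable \<psi>" "AE x in lebesgue. \<phi> x = \<psi> x"
  shows "abs_L2 \<phi> = abs_L2 \<psi>"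
  using Quotient3_rel_abs[OF Quotient3_L2] assms by (simp add: l2_rel_def)

lemma L2_eqI:
  assumes "AE x in lebesgue. rep_L2 u x = rep_L2 v x"
  shows "u = v"
  using abs_L2_cong_AE[OF sq_integrable_rep_L2 sq_integrable_rep_L2 assms] by (simp add: abs_rep_L2)

lemma rep_L2_add_AE: "AE x in lebesgue. rep_L2 (u + v) x = rep_L2 u x + rep_L2 v x"
proof -
  have "u + v = abs_L2 (\<lambda>x. rep_L2 u x + rep_L2 v x)"
    using plus_L2.abs_eq[of "rep_L2 u" "rep_L2 v"]
    by (simp add: l2_rel_def sq_integrable_rep_L2 abs_rep_L2)
  then show ?thesis
    using rep_abs_L2_AE[OF sq_integrable_add[OF sq_integrable_rep_L2 sq_integrable_rep_L2], of u v] by simp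
qed

lemma rep_L2_scaleR_AE: "AE x in lebesgue. rep_L2 (c *\<^sub>R u) x = c * rep_L2 u x"
proof -
  have "c *\<^sub>R u = abs_L2 (\<lambda>x. c * rep_L2 u x)"
    using scaleR_L2.abs_eq[of "rep_L2 u" c]
    by (simp add: l2_rel_def sq_integrable_rep_L2 abs_rep_L2)
  then show ?thesis
    using rep_abs_L2_AE[OF sq_integrable_scale[OF sq_integrable_rep_L2], of c u] by simp
qed

lemma rep_L2_zero_AE: "AE x in lebesgue. rep_L2 0 x = 0"
  using rep_abs_L2_AE[OF sq_integrable_zero] by (simp add: zero_L2_def)

lemma rep_L2_diff_AE: "AE x in lebesgue. rep_L2 (u - v) x = rep_L2 u x - rep_L2 v x"
proof -
  have *: "u - v = u + (-1) *\<^sub>R v" by simp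
  show ?thesis unfolding *
    using rep_L2_add_AE[of u "(-1) *\<^sub>R v"] rep_L2_scaleR_AE[of "-1" v] by eventually_elim simp
qed

lemma inner_L2_eq: "inner u v = (\<integral>x. rep_L2 u x * rep_L2 v x \<partial>lebesgue)"
  using inner_L2.abs_eq[of "rep_L2 u" "rep_L2 v"]
  by (simp add: l2_rel_def sq_integrable_rep_L2 abs_rep_L2)

lemma inner_abs_L2:
  assumes "sq_integrable \<phi>" "sq_integrable \<psi>"
  shows "inner (abs_L2 \<phi>) (abs_L2 \<psi>) = (\<integral>x. \<phi> x * \<psi> x \<partial>lebesgue)"
  by (rule inner_L2.abs_eq) (use assms in \<open>simp_all add: l2_rel_def\<close>)

lemma norm_L2_power2: "(norm u)\<^sup>2 = (\<integral>x. (rep_L2 u x)\<^sup>2 \<partial>lebesgue)"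
  unfolding power2_norm_eq_inner inner_L2_eq by (simp add: power2_eq_square)

lemma integrable_rep_L2_power2: "integrable lebesgue (\<lambda>x. (rep_L2 u x)\<^sup>2)"
  using sq_integrable_rep_L2[of u] by (simp add: sq_integrable_def)

lemma sq_integrable_bound:
  assumes [measurable]: "\<phi> \<in> borel_measurable lebesgue"
    and "sq_integrable \<psi>" "AE x in lebesgue. \<bar>\<phi> x\<bar> \<le> \<bar>\<psi> x\<bar>"
  shows "sq_integrable \<phi>"
proof -
  have "integrable lebesgue (\<lambda>x. (\<phi> x)\<^sup>2)"
  proof (rule Bochner_Integration.integrable_bound)
    show "integrable lebesgue (\<lambda>x. (\<psi> x)\<^sup>2)" using assms(2) by (simp add: sq_integrable_def)
    show "AE x in lebesgue. norm ((\<phi> x)\<^sup>2) \<le> norm ((\<psi> x)\<^sup>2)"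
      using assms(3) by eventually_elim (auto intro: abs_le_square_iff[THEN iffD1])
  qed measurable
  then show ?thesis by (simp add: sq_integrable_def)
qed

lemma norm_L2_mono:
  assumes "AE x in lebesgue. \<bar>rep_L2 u x\<bar> \<le> C * \<bar>rep_L2 v x\<bar>" "C \<ge> 0"
  shows "norm u \<le> C * norm v"
proof (rule power2_le_imp_le)
  have "(norm u)\<^sup>2 \<le> (\<integral>x. C\<^sup>2 * (rep_L2 v x)\<^sup>2 \<partial>lebesgue)"
    unfolding norm_L2_power2
  proof (rule integral_mono_AE)
    show "AE x in lebesgue. (rep_L2 u x)\<^sup>2 \<le> C\<^sup>2 * (rep_L2 v x)\<^sup>2"
      using assms(1)
    proof eventually_elim
      case (elim x)
      then have "\<bar>rep_L2 u x\<bar>\<^sup>2 \<le> (C * \<bar>rep_L2 v x\<bar>)\<^sup>2" by (intro power_mono) auto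
      then show ?case by (simp add: power_mult_distrib)
    qed
  qed (auto intro: integrable_rep_L2_power2)
  also have "\<dots> = (C * norm v)\<^sup>2"
    by (simp add: norm_L2_power2 power_mult_distrib)
  finally show "(norm u)\<^sup>2 \<le> (C * norm v)\<^sup>2" .
qed (use assms(2) in auto)

lemma norm_L2_diff_power2:
  "(norm (u - v))\<^sup>2 = (\<integral>x. (rep_L2 u x - rep_L2 v x)\<^sup>2 \<partial>lebesgue)"
  unfolding norm_L2_power2
proof (rule integral_cong_AE)
  show "AE x in lebesgue. (rep_L2 (u - v) x)\<^sup>2 = (rep_L2 u x - rep_L2 v x)\<^sup>2"
    using rep_L2_diff_AE[of u v] by eventually_elim simp
qed measurable

text \<open>
  Dominated convergence in \<open>L2\<close>.  The hypotheses speak of representatives at every point and not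
  almost everywhere, because uncountably many exceptional null sets, one for each \<open>s\<close>, could not be
  discarded together.
\<close>

lemma tendsto_abs_L2_dominated:
  fixes \<phi> :: "real \<Rightarrow> real \<Rightarrow> real"
  assumes \<phi>: "\<And>s. s > 0 \<Longrightarrow> sq_integrable (\<phi> s)" and \<psi>: "sq_integrable \<psi>" and G: "sq_integrable G"
    and bound: "\<And>s x. s > 0 \<Longrightarrow> \<bar>\<phi> s x\<bar> \<le> \<bar>G x\<bar>"
    and bound': "\<And>x. \<bar>\<psi> x\<bar> \<le> \<bar>G x\<bar>"
    and lim: "\<And>x. ((\<lambda>s. \<phi> s x) \<longlongrightarrow> \<psi> x) (at_right 0)"
  shows "((\<lambda>s. abs_L2 (\<phi> s)) \<longlongrightarrow> abs_L2 \<psi>) (at_right 0)"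
  unfolding tendsto_at_iff_sequentially comp_def
proof (intro allI impI)
  fix r :: "nat \<Rightarrow> real"
  assume r: "\<forall>i. r i \<in> {0<..} - {0}" and r0: "r \<longlonglongrightarrow> 0"
  then have rpos: "r i > 0" for i by auto
  have [measurable]: "\<psi> \<in> borel_measurable lebesgue" "\<phi> (r i) \<in> borel_measurable lebesgue" for i
    using \<psi> \<phi>[OF rpos[of i]] by (auto dest: sq_integrableD)
  have "(\<lambda>i. (norm (abs_L2 (\<phi> (r i)) - abs_L2 \<psi>))\<^sup>2) = (\<lambda>i. \<integral>x. (\<phi> (r i) x - \<psi> x)\<^sup>2 \<partial>lebesgue)"
  proof
    fix i
    show "(norm (abs_L2 (\<phi> (r i)) - abs_L2 \<psi>))\<^sup>2 = (\<integral>x. (\<phi> (r i) x - \<psi> x)\<^sup>2 \<partial>lebesgue)"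
      unfolding norm_L2_diff_power2
    proof (rule integral_cong_AE)
      show "AE x in lebesgue. (rep_L2 (abs_L2 (\<phi> (r i))) x - rep_L2 (abs_L2 \<psi>) x)\<^sup>2 = (\<phi> (r i) x - \<psi> x)\<^sup>2"
        using rep_abs_L2_AE[OF \<phi>[OF rpos[of i]]] rep_abs_L2_AE[OF \<psi>] by eventually_elim simp
    qed measurable
  qed
  also have "\<dots> \<longlonglongrightarrow> (\<integral>x. 0 \<partial>(lebesgue :: real measure))"
  proof (rule integral_dominated_convergence)
    show "integrable lebesgue (\<lambda>x. 4 * (G x)\<^sup>2)" using G by (simp add: sq_integrable_def)
    show "AE x in lebesgue. (\<lambda>i. (\<phi> (r i) x - \<psi> x)\<^sup>2) \<longlonglongrightarrow> 0"
    proof (rule AE_I2)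
      fix x
      have "(\<lambda>i. \<phi> (r i) x) \<longlonglongrightarrow> \<psi> x"
        using lim[of x] r r0 unfolding tendsto_at_iff_sequentially comp_def by blast
      then have "(\<lambda>i. (\<phi> (r i) x - \<psi> x)\<^sup>2) \<longlonglongrightarrow> (\<psi> x - \<psi> x)\<^sup>2" by (intro tendsto_intros)
      then show "(\<lambda>i. (\<phi> (r i) x - \<psi> x)\<^sup>2) \<longlonglongrightarrow> 0" by simp
    qed
    show "AE x in lebesgue. norm ((\<phi> (r i) x - \<psi> x)\<^sup>2) \<le> 4 * (G x)\<^sup>2" for i
    proof (rule AE_I2)
      fix x
      have "\<bar>\<phi> (r i) x - \<psi> x\<bar> \<le> 2 * \<bar>G x\<bar>" using bound[OF rpos[of i], of x] bound'[of x] by linarith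
      then have "\<bar>\<phi> (r i) x - \<psi> x\<bar>\<^sup>2 \<le> (2 * \<bar>G x\<bar>)\<^sup>2" by (intro power_mono) auto
      then show "norm ((\<phi> (r i) x - \<psi> x)\<^sup>2) \<le> 4 * (G x)\<^sup>2" by (simp add: power_mult_distrib)
    qed
  qed measurable
  finally have "(\<lambda>i. (norm (abs_L2 (\<phi> (r i)) - abs_L2 \<psi>))\<^sup>2) \<longlonglongrightarrow> 0" by simp
  then have "(\<lambda>i. sqrt ((norm (abs_L2 (\<phi> (r i)) - abs_L2 \<psi>))\<^sup>2)) \<longlonglongrightarrow> sqrt 0"
    by (rule tendsto_real_sqrt)
  then have "(\<lambda>i. norm (abs_L2 (\<phi> (r i)) - abs_L2 \<psi>)) \<longlonglongrightarrow> 0" by simp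
  then show "(\<lambda>i. abs_L2 (\<phi> (r i))) \<longlonglongrightarrow> abs_L2 \<psi>"
    by (rule LIM_zero_cancel[OF tendsto_norm_zero_cancel])
qed

section \<open>Strongly continuous semigroups on a closed subspace of a Banach space\<close>

text \<open>
  The operator norm \<open>K\<close> of \<open>T\<close> on \<open>H\<close>, together with a unit vector at which \<open>T\<close> almost attains it.
  Any factor strictly between \<open>1/2\<close> and \<open>1\<close> would serve the next proof in place of \<open>3/4\<close>.
\<close>

lemma near_maximal_vector:
  fixes H :: "'a::real_normed_vector set"
  assumes H: "subspace H" and T: "bounded_operator_on H T"
    and u: "u \<in> H" "norm (T u) > C * norm u" and C: "C \<ge> 0"
  obtains K v where "K \<ge> C" "v \<in> H" "norm v = 1" "3/4 * K \<le> norm (T v)"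
    "\<And>w. w \<in> H \<Longrightarrow> norm (T w) \<le> K * norm w"
proof -
  from T have T_scale: "\<And>c w. w \<in> H \<Longrightarrow> T (c *\<^sub>R w) = c *\<^sub>R T w"
    and T_bd: "\<exists>K. \<forall>w\<in>H. norm (T w) \<le> K * norm w"
    by (auto simp: bounded_operator_on_def)
  have T_0: "T 0 = 0" using T_scale[OF u(1), of 0] by simp
  define A where "A = (\<lambda>v. norm (T v)) ` {v \<in> H. norm v = 1}"
  have A_bdd: "bdd_above A"
  proof -
    obtain K0 where "\<forall>w\<in>H. norm (T w) \<le> K0 * norm w" using T_bd by blast
    then show ?thesis unfolding A_def by (intro bdd_aboveI[of _ K0]) force
  qed
  have normalised: "norm (T w) / norm w \<in> A" if "w \<in> H" "w \<noteq> 0" for w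
  proof -
    have "(1 / norm w) *\<^sub>R w \<in> H" using H that by (simp add: subspace_scale)
    moreover have "norm ((1 / norm w) *\<^sub>R w) = 1" using that by simp
    moreover have "norm (T ((1 / norm w) *\<^sub>R w)) = norm (T w) / norm w"
      by (simp add: T_scale[OF that(1)])
    ultimately show ?thesis unfolding A_def by (metis (mono_tags, lifting) imageI mem_Collect_eq)
  qed
  have u0: "u \<noteq> 0" using u C T_0 by auto
  have K_ub: "a \<le> Sup A" if "a \<in> A" for a using that A_bdd by (rule cSup_upper)
  have "C < norm (T u) / norm u" using u(2) u0 by (simp add: field_simps)
  with K_ub[OF normalised[OF u(1) u0]] have K: "C < Sup A" by simp
  then have "3/4 * Sup A < Sup A" using C by simp
  moreover have "A \<noteq> {}" using normalised[OF u(1) u0] by auto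
  ultimately obtain a where a: "a \<in> A" "3/4 * Sup A < a"
    using A_bdd less_cSup_iff by blast
  then obtain v where v: "v \<in> H" "norm v = 1" "3/4 * Sup A < norm (T v)" unfolding A_def by auto
  have "norm (T w) \<le> Sup A * norm w" if "w \<in> H" for w
  proof (cases "w = 0")
    case False
    then show ?thesis using K_ub[OF normalised[OF that False]] by (simp add: field_simps)
  qed (simp add: T_0)
  then show ?thesis using that[of "Sup A" v] K C v by auto
qed

text \<open>
  The uniform boundedness principle by a gliding hump.  If the
  operators are not uniformly bounded, choose operators \<open>T (n k)\<close> of norm \<open>K k \<ge> 4\<^sup>k\<close> and add up steps
  of length \<open>3\<^bsup>-k\<^esup>\<close> in almost norming directions \<open>\<plusminus>v k\<close>.  The sign is chosen so that the
  image of the partial sum under \<open>T (n k)\<close> is at least as long as the image of the step: this is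
  possible as \<open>T (y + e) - T (y - e) = 2 T e\<close>.  All later steps together are shorter than
  \<open>3\<^bsup>-k\<^esup>/2\<close> and spoil at most two thirds of that length, so \<open>T (n k)\<close> maps the limit to a vector of
  length at least \<open>(4/3)\<^sup>k/4\<close>.
\<close>

lemma uniform_boundedness_on:
  fixes T :: "nat \<Rightarrow> 'a::banach \<Rightarrow> 'a"
  assumes H: "subspace H" "closed H" and T: "\<And>n. bounded_operator_on H (T n)"
    and ptw: "\<And>u. u \<in> H \<Longrightarrow> bounded (range (\<lambda>n. T n u))"
  shows "\<exists>K. \<forall>n. \<forall>u\<in>H. norm (T n u) \<le> K * norm u"
proof (rule ccontr)
  assume unbounded: "\<not> ?thesis"
  have "\<exists>n K v. (4::real)^k \<le> K \<and> v \<in> H \<and> norm v = 1 \<and> 3/4 * K \<le> norm (T n v)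
      \<and> (\<forall>w\<in>H. norm (T n w) \<le> K * norm w)" for k
  proof -
    from unbounded have "\<not> (\<forall>n. \<forall>u\<in>H. norm (T n u) \<le> 4^k * norm u)" by blast
    then obtain n u where nu: "u \<in> H" "norm (T n u) > 4^k * norm u" by (auto simp: not_le)
    obtain K v where "K \<ge> 4^k" "v \<in> H" "norm v = 1" "3/4 * K \<le> norm (T n v)"
      "\<And>w. w \<in> H \<Longrightarrow> norm (T n w) \<le> K * norm w"
      by (rule near_maximal_vector[OF H(1) T[of n] nu]) auto
    then show ?thesis by blast
  qed
  then obtain n K v where K: "\<And>k. (4::real)^k \<le> K k" and v: "\<And>k. v k \<in> H" "\<And>k. norm (v k) = 1"
    and Tv: "\<And>k. 3/4 * K k \<le> norm (T (n k) (v k))"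
    and TK: "\<And>k w. w \<in> H \<Longrightarrow> norm (T (n k) w) \<le> K k * norm w"
    by metis
  have T_add: "\<And>k a b. a \<in> H \<Longrightarrow> b \<in> H \<Longrightarrow> T k (a + b) = T k a + T k b"
    and T_scale: "\<And>k c a. a \<in> H \<Longrightarrow> T k (c *\<^sub>R a) = c *\<^sub>R T k a"
    using T by (auto simp: bounded_operator_on_def)
  have step: "\<exists>d. d \<in> H \<and> norm d = (1/3)^k \<and> (1/3)^k * norm (T (n k) (v k)) \<le> norm (T (n k) (y + d))"
    if y: "y \<in> H" for k y
  proof -
    define e where "e = ((1/3)^k :: real) *\<^sub>R v k"
    have e: "e \<in> H" "- e \<in> H" "norm e = (1/3)^k"
      using v H(1) by (auto simp: e_def subspace_scale subspace_neg)
    have "T (n k) (y + e) - T (n k) (y + - e) = 2 *\<^sub>R T (n k) e"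
      using T_add[OF y e(1)] T_add[OF y e(2)] T_scale[OF e(1), of "n k" "-1"]
      by (simp add: scaleR_2)
    then have "2 * norm (T (n k) e) = norm (T (n k) (y + e) - T (n k) (y + - e))" by simp
    also have "\<dots> \<le> norm (T (n k) (y + e)) + norm (T (n k) (y + - e))" by (rule norm_triangle_ineq4)
    finally have "norm (T (n k) e) \<le> norm (T (n k) (y + e)) \<or> norm (T (n k) e) \<le> norm (T (n k) (y + - e))"
      by linarith
    moreover have "norm (T (n k) e) = (1/3)^k * norm (T (n k) (v k))"
      unfolding e_def by (simp add: T_scale[OF v(1)])
    ultimately show ?thesis using e by (metis norm_minus_cancel)
  qed
  define d where "d k y = (SOME d. d \<in> H \<and> norm d = (1/3)^k
      \<and> (1/3)^k * norm (T (n k) (v k)) \<le> norm (T (n k) (y + d)))" for k y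
  have d: "d k y \<in> H" "norm (d k y) = (1/3)^k"
    "(1/3)^k * norm (T (n k) (v k)) \<le> norm (T (n k) (y + d k y))" if "y \<in> H" for k y
    using someI_ex[OF step[OF that, of k]] unfolding d_def by blast+
  define x where "x = rec_nat 0 (\<lambda>k y. y + d k y)"
  have x_Suc: "x (Suc k) = x k + d k (x k)" for k by (simp add: x_def)
  have x_H: "x k \<in> H" for k
    by (induction k) (auto simp: x_Suc d H(1) subspace_add, simp add: x_def H(1) subspace_0)
  define D where "D k = d k (x k)" for k
  have D_norm: "norm (D k) = (1/3)^k" for k by (simp add: D_def d x_H)
  have D_sum: "summable (\<lambda>k. norm (D k))" unfolding D_norm by (rule summable_geometric) simp
  have x_sum: "x k = (\<Sum>i<k. D i)" for k
    by (induction k) (simp_all add: x_Suc D_def, simp add: x_def)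
  define z where "z = suminf D"
  have "x \<longlonglongrightarrow> z"
    using summable_LIMSEQ[OF summable_norm_cancel[OF D_sum]] by (simp add: z_def flip: x_sum)
  then have z_H: "z \<in> H" using H(2) x_H closed_sequentially by blast
  have tail: "norm (z - x (Suc k)) \<le> (1/3)^k / 2" for k
  proof -
    have "z - x (Suc k) = (\<Sum>i. D (i + Suc k))"
      using suminf_minus_initial_segment[OF summable_norm_cancel[OF D_sum], of "Suc k"]
      by (simp add: z_def x_sum)
    also have "norm \<dots> \<le> (\<Sum>i. norm (D (i + Suc k)))"
      by (rule summable_norm) (use D_sum summable_iff_shift[of "\<lambda>k. norm (D k)" "Suc k"] in simp)
    also have "\<dots> = (\<Sum>i. (1/3)^Suc k * (1/3)^i)"
      by (simp add: D_norm power_add mult_ac)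
    also have "\<dots> = (1/3)^Suc k * (\<Sum>i. (1/3)^i)"
      by (rule suminf_mult) (rule summable_geometric, simp)
    also have "\<dots> = (1/3)^k / 2" by (subst suminf_geometric) auto
    finally show ?thesis .
  qed
  obtain B where B: "\<And>k. norm (T k z) \<le> B"
    using ptw[OF z_H] by (auto simp: bounded_iff)
  have "(4/3)^k / 4 \<le> B" for k
  proof -
    have zx: "z - x (Suc k) \<in> H" using z_H x_H H(1) by (simp add: subspace_diff)
    have "T (n k) z = T (n k) (x (Suc k)) + T (n k) (z - x (Suc k))"
      using T_add[OF x_H zx, of "n k" "Suc k"] by simp
    then have "norm (T (n k) (x (Suc k))) \<le> norm (T (n k) z) + norm (T (n k) (z - x (Suc k)))"
      by (metis add_diff_cancel_right' norm_triangle_ineq4)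
    moreover have "norm (T (n k) (z - x (Suc k))) \<le> K k * ((1/3)^k / 2)"
      using order_trans[OF TK[OF zx] mult_left_mono[OF tail]] order_trans[OF _ K[of k], of 0] by simp
    moreover have "(1/3)^k * (3/4 * K k) \<le> norm (T (n k) (x (Suc k)))"
      using order_trans[OF mult_left_mono[OF Tv] d(3)[OF x_H]] by (simp add: x_Suc)
    moreover have "K k * ((1/3)^k / 2) = (1/3)^k * K k / 2" "(1/3)^k * (3/4 * K k) = 3/4 * ((1/3)^k * K k)"
      by simp_all
    ultimately have "(1/3)^k * K k / 4 \<le> B" using B[of "n k"] by linarith
    moreover have "(1/3)^k * 4^k \<le> (1/3)^k * K k" by (rule mult_left_mono) (use K in auto)
    moreover have "(1/3)^k * 4^k = (4/3::real)^k" by (simp add: power_divide)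
    ultimately show ?thesis by linarith
  qed
  then have "(4/3::real)^k \<le> 4 * B" for k by (simp add: field_simps)
  moreover obtain k where "4 * B < (4/3::real)^k" using real_arch_pow[of "4/3" "4 * B"] by auto
  ultimately show False by (metis not_le)
qed

locale c0_semigroup =
  fixes H :: "'a::banach set" and S :: "real \<Rightarrow> 'a \<Rightarrow> 'a"
  assumes subspace: "subspace H" and closed: "closed H" and c0_semigroup_on: "c0_semigroup_on H S"
begin

lemma in_H: "s \<ge> 0 \<Longrightarrow> u \<in> H \<Longrightarrow> S s u \<in> H"
  and add: "s \<ge> 0 \<Longrightarrow> u \<in> H \<Longrightarrow> v \<in> H \<Longrightarrow> S s (u + v) = S s u + S s v"
  and scaleR: "s \<ge> 0 \<Longrightarrow> u \<in> H \<Longrightarrow> S s (c *\<^sub>R u) = c *\<^sub>R S s u"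
  and bounded_operator: "s \<ge> 0 \<Longrightarrow> bounded_operator_on H (S s)"
  and at_zero: "u \<in> H \<Longrightarrow> S 0 u = u"
  and plus: "s \<ge> 0 \<Longrightarrow> t \<ge> 0 \<Longrightarrow> u \<in> H \<Longrightarrow> S (s + t) u = S s (S t u)"
  and tendsto_at_zero: "u \<in> H \<Longrightarrow> ((\<lambda>s. S s u) \<longlongrightarrow> u) (at_right 0)"
  using c0_semigroup_on unfolding c0_semigroup_on_def bounded_operator_on_def by blast+

lemma diff:
  assumes "s \<ge> 0" "u \<in> H" "v \<in> H" shows "S s (u - v) = S s u - S s v"
  using add[of s "u - v" v] assms subspace_diff[OF subspace] by (simp add: algebra_simps)

text \<open>
  Otherwise there are times \<open>s n \<rightarrow> 0\<close> along which the operator norms are unbounded, although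
  \<open>S (s n) v \<rightarrow> v\<close> for every \<open>v\<close>; this contradicts the uniform boundedness principle.
\<close>

lemma locally_bounded: "\<exists>\<delta>>0. \<exists>K. \<forall>s\<in>{0..\<delta>}. \<forall>u\<in>H. norm (S s u) \<le> K * norm u"
proof (rule ccontr)
  assume *: "\<not> ?thesis"
  have "\<exists>s u. 0 \<le> s \<and> s \<le> 1 / real (Suc n) \<and> u \<in> H \<and> \<not> norm (S s u) \<le> real n * norm u" for n
    using *[unfolded not_ex de_Morgan_conj, rule_format, of "1 / real (Suc n)"] by fastforce
  then obtain s u where s: "\<And>n. 0 \<le> s n" "\<And>n. s n \<le> 1 / real (Suc n)"
    and u: "\<And>n. u n \<in> H" "\<And>n. \<not> norm (S (s n) (u n)) \<le> real n * norm (u n)" by metis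
  have s_lim: "s \<longlonglongrightarrow> 0"
  proof (rule tendsto_sandwich[of "\<lambda>_. 0"])
    show "(\<lambda>n. 1 / real (Suc n)) \<longlonglongrightarrow> 0" using LIMSEQ_inverse_real_of_nat by (simp add: inverse_eq_divide)
  qed (use s in auto)
  have "bounded (range (\<lambda>n. S (s n) v))" if v: "v \<in> H" for v
  proof -
    have "((\<lambda>r. S r v) \<longlongrightarrow> S 0 v) (at 0 within {0..})"
      using tendsto_at_zero[OF v] at_zero[OF v] by (simp add: at_within_Ici_at_right)
    then have "continuous (at 0 within {0..}) (\<lambda>r. S r v)" by (simp add: continuous_within)
    then have "(\<lambda>n. S (s n) v) \<longlonglongrightarrow> S 0 v"
      by (rule continuous_within_tendsto_compose') (use s s_lim in auto)
    then show ?thesis by (intro convergent_imp_bounded) (auto simp: convergent_def)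
  qed
  then obtain K where K: "\<And>n u. u \<in> H \<Longrightarrow> norm (S (s n) u) \<le> K * norm u"
    using uniform_boundedness_on[OF subspace closed, of "\<lambda>n. S (s n)"] bounded_operator s by blast
  obtain n where n: "K \<le> real n" using real_arch_simple by blast
  have "norm (S (s n) (u n)) \<le> real n * norm (u n)"
    using order_trans[OF K[OF u(1)] mult_right_mono[OF n]] by simp
  with u show False by blast
qed

text \<open>
  The semigroup law propagates a bound \<open>K\<close> on \<open>[0, \<delta>]\<close> to the bound \<open>K\<^sup>n\<close> on \<open>[0, n \<delta>]\<close>.
\<close>

lemma bounded_on_interval:
  "\<exists>M>0. \<forall>s\<in>{0..t}. \<forall>u\<in>H. norm (S s u) \<le> M * norm u"
proof -
  obtain \<delta> K0 where \<delta>: "\<delta> > 0" and K0: "\<And>s u. 0 \<le> s \<Longrightarrow> s \<le> \<delta> \<Longrightarrow> u \<in> H \<Longrightarrow> norm (S s u) \<le> K0 * norm u"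
    using locally_bounded by (metis atLeastAtMost_iff)
  define K where "K = max 1 K0"
  have K: "norm (S s u) \<le> K * norm u" if "0 \<le> s" "s \<le> \<delta>" "u \<in> H" for s u
    using order_trans[OF K0[OF that] mult_right_mono[of K0 K]] by (simp add: K_def)
  have K1: "K \<ge> 1" by (simp add: K_def)
  have *: "norm (S s u) \<le> K ^ n * norm u" if "0 \<le> s" "s \<le> real n * \<delta>" "u \<in> H" for s u n
    using that
  proof (induction n arbitrary: s u)
    case 0
    then show ?case using at_zero by simp
  next
    case (Suc n)
    show ?case
    proof (cases "s \<le> \<delta>")
      case True
      have "K ^ 1 \<le> K ^ Suc n" by (rule power_increasing) (use K1 in auto)
      then show ?thesis
        using order_trans[OF K[OF Suc.prems(1) True Suc.prems(3)] mult_right_mono[of K "K ^ Suc n"]] by simp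
    next
      case False
      have "S s u = S \<delta> (S (s - \<delta>) u)" using plus[of \<delta> "s - \<delta>" u] Suc.prems False \<delta> by simp
      also have "norm \<dots> \<le> K * norm (S (s - \<delta>) u)"
        by (rule K) (use \<delta> False Suc.prems in \<open>auto intro: in_H\<close>)
      also have "\<dots> \<le> K * (K ^ n * norm u)"
        by (intro mult_left_mono Suc.IH) (use K1 False Suc.prems in \<open>auto simp: algebra_simps\<close>)
      finally show ?thesis by (simp add: mult.assoc)
    qed
  qed
  obtain n where n: "t < real n * \<delta>" using reals_Archimedean3[OF \<delta>] by blast
  have "\<forall>s\<in>{0..t}. \<forall>u\<in>H. norm (S s u) \<le> K ^ n * norm u" using * n by force
  moreover have "K ^ n > 0" using K1 by simp
  ultimately show ?thesis by blast
qed

lemma generatorD: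
  assumes "(u, w) \<in> generator_on H S"
  shows "u \<in> H" "w \<in> H" "((\<lambda>s. (S s u - u) /\<^sub>R s) \<longlongrightarrow> w) (at_right 0)"
  using assms by (auto simp: generator_on_def)

text \<open>
  The generator gives the right derivative at time \<open>0\<close> only.  For two times \<open>a\<close> and \<open>a + r\<close>, one of
  which is \<open>s\<close>, the error of the linear approximation is
  \<open>S a (S r u - u - r w) + r (S a w - S s w)\<close>.  This covers both sides of \<open>s\<close>; the uniform bound on
  \<open>S a\<close> is what makes the left side work, where \<open>a\<close> varies.
\<close>

lemma has_vector_derivative:
  assumes uw: "(u, w) \<in> generator_on H S" and s: "s \<in> {0..t}"
  shows "((\<lambda>s. S s u) has_vector_derivative S s w) (at s within {0..t})"
  unfolding has_vector_derivative_def has_derivative_within_alt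
proof (intro conjI allI impI bounded_linear_scaleR_left)
  note u = generatorD(1)[OF uw] and w = generatorD(2)[OF uw]
  fix e :: real assume e: "e > 0"
  obtain M where M: "M > 0" "\<And>r v. 0 \<le> r \<Longrightarrow> r \<le> t \<Longrightarrow> v \<in> H \<Longrightarrow> norm (S r v) \<le> M * norm v"
    using bounded_on_interval[of t] by auto
  define e' where "e' = e / (2 * M)"
  have e': "e' > 0" "M * e' = e / 2" using e M by (auto simp: e'_def)
  obtain d1 where d1: "d1 > 0" "\<And>r. 0 < r \<Longrightarrow> r < d1 \<Longrightarrow> norm ((S r u - u) /\<^sub>R r - w) < e'"
    using generatorD(3)[OF uw, unfolded tendsto_iff, rule_format, OF e'(1)]
    by (auto simp: eventually_at_right_field dist_norm)
  obtain d2 where d2: "d2 > 0" "\<And>r. 0 < r \<Longrightarrow> r < d2 \<Longrightarrow> norm (S r w - w) < e'"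
    using tendsto_at_zero[OF w, unfolded tendsto_iff, rule_format, OF e'(1)]
    by (auto simp: eventually_at_right_field dist_norm)
  show "\<exists>d>0. \<forall>y\<in>{0..t}. norm (y - s) < d \<longrightarrow> norm (S y u - S s u - (y - s) *\<^sub>R S s w) \<le> e * norm (y - s)"
  proof (intro exI[of _ "min d1 d2"] conjI ballI impI)
    fix y assume y: "y \<in> {0..t}" "norm (y - s) < min d1 d2"
    define r where "r = \<bar>y - s\<bar>"
    define a where "a = min y s"
    show "norm (S y u - S s u - (y - s) *\<^sub>R S s w) \<le> e * norm (y - s)"
    proof (cases "y = s")
      case False
      then have r: "0 < r" "r < d1" "r < d2" using y by (auto simp: r_def)
      have a: "0 \<le> a" "a \<le> t" using y s by (auto simp: a_def)
      have Sr: "S r u \<in> H" "S r w \<in> H" using r u w in_H by auto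
      have shift: "S (a + r) v = S a (S r v)" if "v \<in> H" for v using plus a r that by simp
      have q: "S r u - u - r *\<^sub>R w \<in> H"
        using Sr u w by (intro subspace_diff[OF subspace] subspace_scale[OF subspace])
      have "S r u - u - r *\<^sub>R w = r *\<^sub>R ((S r u - u) /\<^sub>R r - w)"
        using r by (simp add: scaleR_diff_right)
      then have "norm (S r u - u - r *\<^sub>R w) \<le> r * e'"
        using d1(2)[OF r(1,2)] r by simp
      then have 1: "norm (S a (S r u - u - r *\<^sub>R w)) \<le> M * (r * e')"
        using order_trans[OF M(2)[OF a q] mult_left_mono] M(1) by simp
      have 2: "norm (S a w - S s w) \<le> M * e'"
      proof (cases "y < s")
        case True
        then have "s = a + r" by (simp add: a_def r_def)
        then have "norm (S a w - S s w) = norm (S a (S r w - w))"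
          using diff[OF a(1) Sr(2) w] shift[OF w] by (simp add: norm_minus_commute)
        also have "\<dots> \<le> M * norm (S r w - w)"
          by (rule M(2)[OF a subspace_diff[OF subspace Sr(2) w]])
        also have "\<dots> \<le> M * e'" using d2(2)[OF r(1,3)] M(1) by simp
        finally show ?thesis .
      next
        case False
        then show ?thesis using M(1) e' by (simp add: a_def)
      qed
      have "norm (S y u - S s u - (y - s) *\<^sub>R S s w) = norm (S (a + r) u - S a u - r *\<^sub>R S s w)"
      proof (cases "y < s")
        case True
        then have ar: "a = y" "a + r = s" "y - s = - r" by (auto simp: a_def r_def)
        have "S y u - S s u - (y - s) *\<^sub>R S s w = - (S (a + r) u - S a u - r *\<^sub>R S s w)"
          unfolding ar(3) using ar(1,2) by (auto simp: algebra_simps)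
        then show ?thesis by (simp only: norm_minus_cancel)
      next
        case False
        then have ar: "a + r = y" "y - s = r" "s = a" by (auto simp: a_def r_def)
        show ?thesis unfolding ar(1,2) by (simp add: ar(3))
      qed
      also have "S (a + r) u - S a u - r *\<^sub>R S s w
          = S a (S r u - u - r *\<^sub>R w) + r *\<^sub>R (S a w - S s w)"
        using a Sr u w
        by (simp add: shift diff scaleR subspace_diff[OF subspace] subspace_scale[OF subspace] scaleR_diff_right)
      also have "norm \<dots> \<le> M * (r * e') + r * (M * e')"
        using norm_triangle_mono[OF 1, of "r *\<^sub>R (S a w - S s w)" "r * (M * e')"] 2 r by simp
      also have "\<dots> = e * norm (y - s)" using e'(2) by (simp add: r_def[symmetric] algebra_simps)
      finally show ?thesis .
    qed simp
  qed (use d1 d2 in auto)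
qed

lemma generator_invariant:
  assumes uw: "(u, w) \<in> generator_on H S" and s: "s \<ge> 0"
  shows "(S s u, S s w) \<in> generator_on H S"
proof -
  note u = generatorD(1)[OF uw] and w = generatorD(2)[OF uw]
  obtain M where M: "\<And>v. v \<in> H \<Longrightarrow> norm (S s v) \<le> M * norm v"
    using bounded_operator[OF s] unfolding bounded_operator_on_def by blast
  have "((\<lambda>r. (S r (S s u) - S s u) /\<^sub>R r) \<longlongrightarrow> S s w) (at_right 0)"
  proof (rule LIM_zero_cancel, rule Lim_null_comparison)
    have "((\<lambda>r. M * norm ((S r u - u) /\<^sub>R r - w)) \<longlongrightarrow> M * norm (w - w)) (at_right 0)"
      by (intro tendsto_intros generatorD(3)[OF uw])
    then show "((\<lambda>r. M * norm ((S r u - u) /\<^sub>R r - w)) \<longlongrightarrow> 0) (at_right 0)" by simp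
    show "\<forall>\<^sub>F r in at_right 0. norm ((S r (S s u) - S s u) /\<^sub>R r - S s w) \<le> M * norm ((S r u - u) /\<^sub>R r - w)"
      using eventually_at_right_less[of 0]
    proof eventually_elim
      case (elim r)
      have Sr: "S r u \<in> H" using elim u in_H by simp
      have "S r (S s u) = S s (S r u)" using plus[of r s u] plus[of s r u] elim s u by (simp add: add.commute)
      then have "(S r (S s u) - S s u) /\<^sub>R r - S s w = S s ((S r u - u) /\<^sub>R r - w)"
        using s Sr u w by (simp add: diff scaleR subspace_diff[OF subspace] subspace_scale[OF subspace])
      moreover have "(S r u - u) /\<^sub>R r - w \<in> H"
        using Sr u w by (intro subspace_diff[OF subspace] subspace_scale[OF subspace])
      ultimately show ?case using M by simp
    qed
  qed
  then show ?thesis using in_H s u w by (simp add: generator_on_def)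
qed

text \<open>
  The fundamental theorem of calculus for the orbit of \<open>w\<close> run at double speed.
\<close>

lemma has_integral_double_speed:
  assumes wz: "(w, z) \<in> generator_on H S" and t: "t \<ge> 0"
  shows "((\<lambda>s. S s (S s z)) has_integral (1/2) *\<^sub>R (S (2 * t) w - w)) {0..t}"
proof -
  note w = generatorD(1)[OF wz] and z = generatorD(2)[OF wz]
  have "((\<lambda>s. S (2 * s) z) has_integral (1/2) *\<^sub>R S (2 * t) w - (1/2) *\<^sub>R S (2 * 0) w) {0..t}"
  proof (rule fundamental_theorem_of_calculus[OF t])
    fix s assume s: "s \<in> {0..t}"
    have "((\<lambda>s. S s w) has_vector_derivative S (2 * s) z) (at (2 * s) within (*) 2 ` {0..t})"
      using has_vector_derivative[OF wz, of "2 * s" "2 * t"] s by (simp add: image_mult_atLeastAtMost)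
    moreover have "((*) 2 has_vector_derivative (2::real)) (at s within {0..t})"
      by (auto intro!: derivative_eq_intros)
    ultimately have "((\<lambda>s. S s w) \<circ> (*) 2 has_vector_derivative 2 *\<^sub>R S (2 * s) z) (at s within {0..t})"
      by (intro vector_diff_chain_within)
    then have "((\<lambda>s. (1/2) *\<^sub>R S (2 * s) w) has_vector_derivative (1/2) *\<^sub>R 2 *\<^sub>R S (2 * s) z) (at s within {0..t})"
      unfolding comp_def by (rule has_vector_derivative_scaleR[OF DERIV_const, of _ _ _ _ "1/2", simplified])
    then show "((\<lambda>s. (1/2) *\<^sub>R S (2 * s) w) has_vector_derivative S (2 * s) z) (at s within {0..t})" by simp
  qed
  then have "((\<lambda>s. S (2 * s) z) has_integral (1/2) *\<^sub>R (S (2 * t) w - w)) {0..t}"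
    using at_zero[OF w] by (simp add: scaleR_diff_right)
  moreover have "S (2 * s) z = S s (S s z)" if "s \<in> {0..t}" for s
    using plus[of s s z] z that by simp
  ultimately show ?thesis
    by (rule has_integral_eq[rotated])
qed

end

text \<open>
  Gronwall's argument: the derivative of \<open>e\<^bsup>-2ps\<^esup> \<parallel>S s u\<parallel>\<^sup>2\<close> is
  \<open>2 e\<^bsup>-2ps\<^esup> (\<langle>S s u, A (S s u)\<rangle> - p \<parallel>S s u\<parallel>\<^sup>2) \<le> 0\<close>.
\<close>

lemma dissipative_semigroup_decay:
  fixes H :: "'a::{banach, real_inner} set"
  assumes S: "c0_semigroup H S"
    and diss: "\<And>u w. (u, w) \<in> generator_on H S \<Longrightarrow> inner u w \<le> p * (norm u)\<^sup>2"
    and uw: "(u, w) \<in> generator_on H S" and t: "t \<ge> 0"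
  shows "norm (S t u) \<le> exp (p * t) * norm u"
proof -
  define \<psi> where "\<psi> s = exp (- 2 * p * s) * inner (S s u) (S s u)" for s
  have der: "(\<psi> has_real_derivative
      exp (- 2 * p * s) * (2 * inner (S s u) (S s w) - 2 * p * inner (S s u) (S s u))) (at s within {0..t})"
    if s: "s \<in> {0..t}" for s
  proof -
    have "((\<lambda>s. inner (S s u) (S s u)) has_vector_derivative
        inner (S s u) (S s w) + inner (S s w) (S s u)) (at s within {0..t})"
      by (rule bounded_bilinear.has_vector_derivative[OF bounded_bilinear_inner])
        (rule c0_semigroup.has_vector_derivative[OF S uw s])+
    then have "((\<lambda>s. inner (S s u) (S s u)) has_real_derivative 2 * inner (S s u) (S s w)) (at s within {0..t})"
      by (simp add: has_real_derivative_iff_has_vector_derivative inner_commute[of "S s w"])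
    then show ?thesis unfolding \<psi>_def
      by (auto intro!: derivative_eq_intros simp: algebra_simps)
  qed
  have "\<psi> t \<le> \<psi> 0"
  proof (rule DERIV_nonpos_imp_decreasing_open[of 0 t \<psi>])
    show "0 \<le> t" by (rule t)
    show "continuous_on {0..t} \<psi>" using der by (rule DERIV_continuous_on)
    fix s assume s: "0 < s" "s < t"
    have "inner (S s u) (S s w) \<le> p * (norm (S s u))\<^sup>2"
      using diss c0_semigroup.generator_invariant[OF S uw] s by simp
    then have "exp (- 2 * p * s) * (2 * inner (S s u) (S s w) - 2 * p * inner (S s u) (S s u)) \<le> 0"
      by (intro mult_nonneg_nonpos) (auto simp: power2_norm_eq_inner)
    moreover have "(\<psi> has_real_derivative
      exp (- 2 * p * s) * (2 * inner (S s u) (S s w) - 2 * p * inner (S s u) (S s u))) (at s)"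
      using der[of s] s by (simp add: at_within_Icc_at)
    ultimately show "\<exists>y. (\<psi> has_real_derivative y) (at s) \<and> y \<le> 0" by blast
  qed
  then have "exp (- 2 * p * t) * (norm (S t u))\<^sup>2 \<le> (norm u)\<^sup>2"
    using c0_semigroup.at_zero[OF S] c0_semigroup.generatorD(1)[OF S uw]
    by (simp add: \<psi>_def power2_norm_eq_inner)
  then have "exp (2 * p * t) * (exp (- 2 * p * t) * (norm (S t u))\<^sup>2) \<le> exp (2 * p * t) * (norm u)\<^sup>2"
    by (rule mult_left_mono) simp
  then have "(norm (S t u))\<^sup>2 \<le> (exp (p * t) * norm u)\<^sup>2"
    by (simp add: power_mult_distrib exp_double[symmetric] mult.assoc[symmetric] exp_add[symmetric])
  then show ?thesis by (rule power2_le_imp_le) simp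
qed

section \<open>The semigroup generated by a negative multiplication operator\<close>

lemma L2_on_iff: "u \<in> L2_on X \<longleftrightarrow> (AE x in lebesgue. x \<notin> X \<longrightarrow> rep_L2 u x = 0)"
  by (simp add: L2_on_def)

lemma subspace_L2_on: "subspace (L2_on X)"
proof (rule subspaceI)
  show "0 \<in> L2_on X"
    unfolding L2_on_iff using rep_L2_zero_AE by eventually_elim simp
  show "u + v \<in> L2_on X" if "u \<in> L2_on X" "v \<in> L2_on X" for u v
    using that rep_L2_add_AE[of u v] unfolding L2_on_iff by eventually_elim simp
  show "c *\<^sub>R u \<in> L2_on X" if "u \<in> L2_on X" for c u
    using that rep_L2_scaleR_AE[of c u] unfolding L2_on_iff by eventually_elim simp
qed

text \<open>
  The part \<open>v\<close> of a limit \<open>u\<close> off \<open>X\<close> is no longer than \<open>U n - u\<close> if \<open>U n\<close> vanishes off \<open>X\<close>.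
\<close>

lemma closed_L2_on:
  assumes X [measurable]: "X \<in> sets lebesgue"
  shows "closed (L2_on X)"
  unfolding closed_sequential_limits
proof (intro allI impI, elim conjE)
  fix U u assume U: "\<forall>n. U n \<in> L2_on X" and lim: "U \<longlonglongrightarrow> u"
  define v where "v = abs_L2 (\<lambda>x. if x \<in> X then 0 else rep_L2 u x)"
  have v: "AE x in lebesgue. rep_L2 v x = (if x \<in> X then 0 else rep_L2 u x)"
    unfolding v_def by (rule rep_abs_L2_AE, rule sq_integrable_bound[OF _ sq_integrable_rep_L2[of u]]) auto
  have "norm v \<le> norm (U n - u)" for n
  proof -
    have "AE x in lebesgue. x \<notin> X \<longrightarrow> rep_L2 (U n) x = 0" using U by (simp add: L2_on_iff)
    with v rep_L2_diff_AE[of "U n" u] have "AE x in lebesgue. \<bar>rep_L2 v x\<bar> \<le> 1 * \<bar>rep_L2 (U n - u) x\<bar>"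
      by eventually_elim auto
    from norm_L2_mono[OF this] show ?thesis by simp
  qed
  moreover have "(\<lambda>n. norm (U n - u)) \<longlonglongrightarrow> norm (u - u)" by (intro tendsto_intros lim)
  ultimately have "norm v \<le> norm (u - u)" by (intro LIMSEQ_le_const) auto
  then have "AE x in lebesgue. rep_L2 v x = 0" using rep_L2_zero_AE by simp
  with v show "u \<in> L2_on X"
    unfolding L2_on_iff by eventually_elim (auto split: if_splits)
qed

definition mult_semigroup :: "real set \<Rightarrow> (real \<Rightarrow> real) \<Rightarrow> real \<Rightarrow> L2 \<Rightarrow> L2" where
  "mult_semigroup X h s u = abs_L2 (\<lambda>x. if x \<in> X then exp (s * h x) * rep_L2 u x else 0)"

lemma tendsto_exp_diff_quotient:
  "((\<lambda>s. (exp (s * a) - 1) / s) \<longlongrightarrow> a) (at_right (0::real))"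
proof -
  have "((\<lambda>s. exp (s * a)) has_real_derivative a) (at 0)"
    by (auto intro!: derivative_eq_intros)
  then have "((\<lambda>s. (exp (s * a) - 1) / s) \<longlongrightarrow> a) (at 0)"
    by (simp add: has_field_derivative_iff)
  then show ?thesis by (rule tendsto_within_subset) auto
qed

lemma abs_exp_diff_quotient_le:
  fixes a s :: real
  assumes "a \<le> 0" "s > 0"
  shows "\<bar>(exp (s * a) - 1) / s\<bar> \<le> \<bar>a\<bar>"
proof -
  have "exp (s * a) \<le> 1" using assms by (simp add: mult_nonneg_nonpos)
  moreover have "1 + s * a \<le> exp (s * a)" by (rule exp_ge_add_one_self)
  moreover have "s * \<bar>a\<bar> = - (s * a)" using assms by simp
  ultimately have "\<bar>exp (s * a) - 1\<bar> \<le> s * \<bar>a\<bar>" by linarith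
  then show ?thesis using assms by (simp add: field_simps)
qed

text \<open>
  The upper bound \<open>p < 0\<close> on \<open>h\<close> makes the exponentials contractions and the orbits decay; \<open>h\<close> may be
  unbounded below.
\<close>

locale dissipative_multiplier =
  fixes X :: "real set" and h :: "real \<Rightarrow> real" and p :: real
  assumes X [measurable]: "X \<in> sets lebesgue" and h_measurable: "h \<in> borel_measurable (lebesgue_on X)"
    and h_le: "\<And>x. x \<in> X \<Longrightarrow> h x \<le> p" and p_neg: "p < 0"
begin

lemma h_neg: "x \<in> X \<Longrightarrow> h x < 0"
  using h_le p_neg by fastforce

lemma measurable_mult:
  assumes F: "F \<in> borel_measurable borel" and v: "v \<in> borel_measurable lebesgue"
  shows "(\<lambda>x. if x \<in> X then F (h x) * v x else 0 :: real) \<in> borel_measurable lebesgue"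
proof -
  have "(\<lambda>x. F (h x) * v x) \<in> borel_measurable (lebesgue_on X)"
    using measurable_compose[OF h_measurable F] v by (auto intro!: borel_measurable_times intro: measurable_restrict_space1)
  then show ?thesis by (simp add: borel_measurable_if[OF X])
qed

lemma sq_integrable_semigroup:
  assumes "s \<ge> 0"
  shows "sq_integrable (\<lambda>x. if x \<in> X then exp (s * h x) * rep_L2 u x else 0)"
proof (rule sq_integrable_bound[OF _ sq_integrable_rep_L2[of u]])
  show "(\<lambda>x. if x \<in> X then exp (s * h x) * rep_L2 u x else 0) \<in> borel_measurable lebesgue"
    by (rule measurable_mult) measurable
  show "AE x in lebesgue. \<bar>if x \<in> X then exp (s * h x) * rep_L2 u x else 0\<bar> \<le> \<bar>rep_L2 u x\<bar>"
    using assms h_neg by (intro AE_I2) (auto simp: abs_mult mult_nonneg_nonpos less_imp_le intro!: mult_left_le_one_le)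
qed

lemma rep_mult_semigroup_AE:
  assumes "s \<ge> 0"
  shows "AE x in lebesgue. rep_L2 (mult_semigroup X h s u) x = (if x \<in> X then exp (s * h x) * rep_L2 u x else 0)"
  unfolding mult_semigroup_def by (rule rep_abs_L2_AE[OF sq_integrable_semigroup[OF assms]])

lemma c0_semigroup_mult_semigroup: "c0_semigroup_on (L2_on X) (mult_semigroup X h)"
  unfolding c0_semigroup_on_def bounded_operator_on_def
proof (intro conjI allI impI ballI)
  fix s :: real and u v :: L2 and c :: real assume s: "0 \<le> s"
  note rep = rep_mult_semigroup_AE[OF s]
  show "mult_semigroup X h s u \<in> L2_on X"
    unfolding L2_on_iff using rep[of u] by eventually_elim simp
  show "mult_semigroup X h s (u + v) = mult_semigroup X h s u + mult_semigroup X h s v"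
    by (rule L2_eqI, use rep[of u] rep[of v] rep[of "u + v"] rep_L2_add_AE[of u v]
        rep_L2_add_AE[of "mult_semigroup X h s u" "mult_semigroup X h s v"] in eventually_elim)
      (simp add: distrib_left)
  show "mult_semigroup X h s (c *\<^sub>R u) = c *\<^sub>R mult_semigroup X h s u"
    by (rule L2_eqI, use rep[of u] rep[of "c *\<^sub>R u"] rep_L2_scaleR_AE[of c u]
        rep_L2_scaleR_AE[of c "mult_semigroup X h s u"] in eventually_elim) simp
  show "mult_semigroup X h (s + t) u = mult_semigroup X h s (mult_semigroup X h t u)" if t: "0 \<le> t" for t
    by (rule L2_eqI, use rep_mult_semigroup_AE[OF add_nonneg_nonneg[OF s t], of u]
        rep[of "mult_semigroup X h t u"] rep_mult_semigroup_AE[OF t, of u] in eventually_elim)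
      (simp add: distrib_right exp_add)
next
  fix s :: real assume s: "0 \<le> s"
  have "norm (mult_semigroup X h s u) \<le> 1 * norm u" for u
  proof (rule norm_L2_mono)
    show "AE x in lebesgue. \<bar>rep_L2 (mult_semigroup X h s u) x\<bar> \<le> 1 * \<bar>rep_L2 u x\<bar>"
      using rep_mult_semigroup_AE[OF s, of u]
      by eventually_elim (use s h_neg in \<open>auto simp: abs_mult mult_nonneg_nonpos less_imp_le intro!: mult_left_le_one_le\<close>)
  qed simp
  then show "\<exists>K. \<forall>u\<in>L2_on X. norm (mult_semigroup X h s u) \<le> K * norm u" by blast
next
  fix u assume u: "u \<in> L2_on X"
  show "mult_semigroup X h 0 u = u"
    by (rule L2_eqI, use rep_mult_semigroup_AE[OF order_refl, of u] u[unfolded L2_on_iff] in eventually_elim) auto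
  have "((\<lambda>s. mult_semigroup X h s u) \<longlongrightarrow> abs_L2 (\<lambda>x. if x \<in> X then rep_L2 u x else 0)) (at_right 0)"
    unfolding mult_semigroup_def
  proof (rule tendsto_abs_L2_dominated[OF _ _ sq_integrable_rep_L2[of u]])
    show "sq_integrable (\<lambda>x. if x \<in> X then exp (s * h x) * rep_L2 u x else 0)" if "s > 0" for s
      using sq_integrable_semigroup that by simp
    show "sq_integrable (\<lambda>x. if x \<in> X then rep_L2 u x else 0)"
      using sq_integrable_semigroup[of 0 u] by (simp cong: if_cong)
    show "\<bar>if x \<in> X then exp (s * h x) * rep_L2 u x else 0\<bar> \<le> \<bar>rep_L2 u x\<bar>" if "s > 0" for s x
      using that h_neg by (auto simp: abs_mult mult_nonneg_nonpos less_imp_le intro!: mult_left_le_one_le)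
    show "((\<lambda>s. if x \<in> X then exp (s * h x) * rep_L2 u x else 0) \<longlongrightarrow> (if x \<in> X then rep_L2 u x else 0)) (at_right 0)" for x
    proof -
      have "((\<lambda>s. exp (s * h x) * rep_L2 u x) \<longlongrightarrow> exp (0 * h x) * rep_L2 u x) (at_right 0)"
        by (intro tendsto_intros)
      then show ?thesis by auto
    qed
  qed auto
  moreover have "abs_L2 (\<lambda>x. if x \<in> X then rep_L2 u x else 0) = u"
    using \<open>mult_semigroup X h 0 u = u\<close> by (simp add: mult_semigroup_def cong: if_cong)
  ultimately show "((\<lambda>s. mult_semigroup X h s u) \<longlongrightarrow> u) (at_right 0)" by simp
qed

lemma rep_diff_quotient_AE:
  assumes s: "s > 0" and u: "u \<in> L2_on X"
  shows "AE x in lebesgue. rep_L2 ((mult_semigroup X h s u - u) /\<^sub>R s) x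
    = (if x \<in> X then (exp (s * h x) - 1) / s * rep_L2 u x else 0)"
  using rep_mult_semigroup_AE[OF less_imp_le[OF s], of u] u[unfolded L2_on_iff]
    rep_L2_diff_AE[of "mult_semigroup X h s u" u]
    rep_L2_scaleR_AE[of "inverse s" "mult_semigroup X h s u - u"]
  by eventually_elim (use s in \<open>auto simp: field_simps\<close>)

text \<open>
  The difference quotients \<open>(e\<^bsup>sh\<^esup> - 1)/s\<close> converge pointwise to \<open>h\<close> and are dominated by \<open>\<bar>h\<bar>\<close>, as
  \<open>h \<le> 0\<close>; on the maximal domain \<open>h u\<close> is square-integrable.
\<close>

lemma mult_op_subset_generator: "mult_op X h \<subseteq> generator_on (L2_on X) (mult_semigroup X h)"
proof (rule subrelI)
  fix u w assume uw: "(u, w) \<in> mult_op X h"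
  then have u: "u \<in> L2_on X" and w: "w \<in> L2_on X"
    and hu: "AE x in lebesgue. x \<in> X \<longrightarrow> rep_L2 w x = h x * rep_L2 u x"
    by (auto simp: mult_op_def)
  define \<phi> where "\<phi> s x = (if x \<in> X then (exp (s * h x) - 1) / s * rep_L2 u x else 0)" for s x
  define \<psi> where "\<psi> x = (if x \<in> X then h x * rep_L2 u x else 0)" for x
  have \<psi>_w: "AE x in lebesgue. \<psi> x = rep_L2 w x"
    using hu w[unfolded L2_on_iff] by eventually_elim (auto simp: \<psi>_def)
  have \<psi>_sq: "sq_integrable \<psi>"
  proof (rule sq_integrable_bound[OF _ sq_integrable_rep_L2[of w]])
    show "\<psi> \<in> borel_measurable lebesgue" unfolding \<psi>_def[abs_def] by (rule measurable_mult) measurable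
    show "AE x in lebesgue. \<bar>\<psi> x\<bar> \<le> \<bar>rep_L2 w x\<bar>" using \<psi>_w by eventually_elim simp
  qed
  have \<phi>_le: "\<bar>\<phi> s x\<bar> \<le> \<bar>\<psi> x\<bar>" if "s > 0" for s x
    using mult_right_mono[OF abs_exp_diff_quotient_le[OF less_imp_le[OF h_neg] that, of x], of "\<bar>rep_L2 u x\<bar>"]
    by (simp add: \<phi>_def \<psi>_def abs_mult)
  have \<phi>_sq: "sq_integrable (\<phi> s)" if "s > 0" for s
  proof (rule sq_integrable_bound[OF _ \<psi>_sq])
    show "\<phi> s \<in> borel_measurable lebesgue" unfolding \<phi>_def[abs_def]
      by (rule measurable_mult[where F = "\<lambda>y. (exp (s * y) - 1) / s"]) measurable
    show "AE x in lebesgue. \<bar>\<phi> s x\<bar> \<le> \<bar>\<psi> x\<bar>" using \<phi>_le[OF that] by simp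
  qed
  have lim: "((\<lambda>s. abs_L2 (\<phi> s)) \<longlongrightarrow> abs_L2 \<psi>) (at_right 0)"
  proof (rule tendsto_abs_L2_dominated[OF \<phi>_sq \<psi>_sq \<psi>_sq \<phi>_le])
    show "((\<lambda>s. \<phi> s x) \<longlongrightarrow> \<psi> x) (at_right 0)" for x
      unfolding \<phi>_def \<psi>_def
      by (cases "x \<in> X") (simp_all only: if_True if_False tendsto_const tendsto_mult[OF tendsto_exp_diff_quotient tendsto_const])
  qed auto
  have \<psi>_eq: "abs_L2 \<psi> = w"
    using abs_L2_cong_AE[OF \<psi>_sq sq_integrable_rep_L2 \<psi>_w] by (simp add: abs_rep_L2)
  have "\<forall>\<^sub>F s in at_right 0. abs_L2 (\<phi> s) = (mult_semigroup X h s u - u) /\<^sub>R s"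
    using eventually_at_right_less[of "0::real"]
  proof eventually_elim
    case (elim s)
    show ?case
    proof (rule L2_eqI)
      show "AE x in lebesgue. rep_L2 (abs_L2 (\<phi> s)) x = rep_L2 ((mult_semigroup X h s u - u) /\<^sub>R s) x"
        using rep_abs_L2_AE[OF \<phi>_sq[OF elim]] rep_diff_quotient_AE[OF elim u]
        by eventually_elim (simp add: \<phi>_def)
    qed
  qed
  then have "((\<lambda>s. (mult_semigroup X h s u - u) /\<^sub>R s) \<longlongrightarrow> w) (at_right 0)"
    by (rule Lim_transform_eventually[OF lim[unfolded \<psi>_eq]])
  then show "(u, w) \<in> generator_on (L2_on X) (mult_semigroup X h)"
    using u w by (simp add: generator_on_def)
qed

text \<open>
  Here \<open>h u\<close> is not known to be square-integrable, so there is no dominating function.  Fatou's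
  lemma suffices: along \<open>s = 1/n\<close> the difference quotients converge pointwise to \<open>h u\<close> and in norm to
  \<open>w\<close>, hence the square of \<open>h u - w\<close> has integral \<open>0\<close>.
\<close>

lemma generator_subset_mult_op: "generator_on (L2_on X) (mult_semigroup X h) \<subseteq> mult_op X h"
proof (rule subrelI)
  fix u w assume "(u, w) \<in> generator_on (L2_on X) (mult_semigroup X h)"
  then have u: "u \<in> L2_on X" and w: "w \<in> L2_on X"
    and lim: "((\<lambda>s. (mult_semigroup X h s u - u) /\<^sub>R s) \<longlongrightarrow> w) (at_right 0)"
    by (auto simp: generator_on_def)
  define r where "r i = inverse (real (Suc i))" for i
  have r: "r i > 0" for i by (simp add: r_def)
  have r_lim: "filterlim r (at_right 0) sequentially"
    unfolding r_def by (rule tendsto_imp_filterlim_at_right[OF LIMSEQ_inverse_real_of_nat]) auto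
  define D where "D i = (mult_semigroup X h (r i) u - u) /\<^sub>R r i" for i
  have D_lim: "D \<longlonglongrightarrow> w"
    unfolding D_def using filterlim_compose[OF lim r_lim] .
  define \<psi> where "\<psi> x = (if x \<in> X then h x * rep_L2 u x else 0)" for x
  have [measurable]: "\<psi> \<in> borel_measurable lebesgue"
    unfolding \<psi>_def[abs_def] by (rule measurable_mult) measurable
  have "AE x in lebesgue. \<forall>i. rep_L2 (D i) x = (if x \<in> X then (exp (r i * h x) - 1) / r i * rep_L2 u x else 0)"
    unfolding AE_all_countable D_def using rep_diff_quotient_AE[OF r u] by blast
  then have ptw: "AE x in lebesgue. (\<lambda>i. rep_L2 (D i) x) \<longlonglongrightarrow> \<psi> x"
  proof eventually_elim
    case (elim x)
    have "(\<lambda>i. (exp (r i * h x) - 1) / r i * rep_L2 u x) \<longlonglongrightarrow> h x * rep_L2 u x"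
      by (intro tendsto_mult tendsto_const filterlim_compose[OF tendsto_exp_diff_quotient r_lim])
    then show ?case by (auto simp: elim \<psi>_def)
  qed
  have nn: "ennreal ((norm (D i - w))\<^sup>2) = (\<integral>\<^sup>+x. ennreal ((rep_L2 (D i) x - rep_L2 w x)\<^sup>2) \<partial>lebesgue)" for i
  proof -
    have "sq_integrable (\<lambda>x. rep_L2 (D i) x + (- 1) * rep_L2 w x)"
      by (intro sq_integrable_add sq_integrable_scale sq_integrable_rep_L2)
    then have "integrable lebesgue (\<lambda>x. (rep_L2 (D i) x - rep_L2 w x)\<^sup>2)" by (simp add: sq_integrable_def)
    then show ?thesis unfolding norm_L2_diff_power2 by (intro nn_integral_eq_integral[symmetric]) auto
  qed
  have "(\<integral>\<^sup>+x. ennreal ((\<psi> x - rep_L2 w x)\<^sup>2) \<partial>lebesgue)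
      = (\<integral>\<^sup>+x. liminf (\<lambda>i. ennreal ((rep_L2 (D i) x - rep_L2 w x)\<^sup>2)) \<partial>lebesgue)"
  proof (rule nn_integral_cong_AE)
    show "AE x in lebesgue. ennreal ((\<psi> x - rep_L2 w x)\<^sup>2) = liminf (\<lambda>i. ennreal ((rep_L2 (D i) x - rep_L2 w x)\<^sup>2))"
      using ptw
    proof eventually_elim
      case (elim x)
      have "(\<lambda>i. ennreal ((rep_L2 (D i) x - rep_L2 w x)\<^sup>2)) \<longlonglongrightarrow> ennreal ((\<psi> x - rep_L2 w x)\<^sup>2)"
        by (intro tendsto_intros elim)
      then show ?case by (intro lim_imp_Liminf[symmetric]) simp_all
    qed
  qed
  also have "\<dots> \<le> liminf (\<lambda>i. \<integral>\<^sup>+x. ennreal ((rep_L2 (D i) x - rep_L2 w x)\<^sup>2) \<partial>lebesgue)"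
    by (rule nn_integral_liminf) measurable
  also have "\<dots> = 0"
  proof -
    have "(\<lambda>i. ennreal ((norm (D i - w))\<^sup>2)) \<longlonglongrightarrow> ennreal ((norm (w - w))\<^sup>2)"
      by (intro tendsto_intros D_lim)
    then have "(\<lambda>i. ennreal ((norm (D i - w))\<^sup>2)) \<longlonglongrightarrow> 0" by simp
    then show ?thesis unfolding nn by (intro lim_imp_Liminf) simp_all
  qed
  finally have "(\<integral>\<^sup>+x. ennreal ((\<psi> x - rep_L2 w x)\<^sup>2) \<partial>lebesgue) = 0" by simp
  then have "AE x in lebesgue. ennreal ((\<psi> x - rep_L2 w x)\<^sup>2) = 0"
    by (subst (asm) nn_integral_0_iff_AE) auto
  then have "AE x in lebesgue. x \<in> X \<longrightarrow> rep_L2 w x = h x * rep_L2 u x"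
    by eventually_elim (auto simp: \<psi>_def ennreal_eq_0_iff)
  then show "(u, w) \<in> mult_op X h" using u w by (simp add: mult_op_def)
qed

text \<open>
  The choice in the definition of \<open>op_exp\<close> is made from a nonempty set, so the chosen semigroup has
  the required properties, whichever it is.
\<close>

lemma op_exp_mult_op:
  "c0_semigroup (L2_on X) (op_exp (L2_on X) (mult_op X h))"
  "generator_on (L2_on X) (op_exp (L2_on X) (mult_op X h)) = mult_op X h"
proof -
  have "c0_semigroup_on (L2_on X) (mult_semigroup X h) \<and> generator_on (L2_on X) (mult_semigroup X h) = mult_op X h"
    using c0_semigroup_mult_semigroup mult_op_subset_generator generator_subset_mult_op by blast
  then have *: "c0_semigroup_on (L2_on X) (op_exp (L2_on X) (mult_op X h))
      \<and> generator_on (L2_on X) (op_exp (L2_on X) (mult_op X h)) = mult_op X h"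
    unfolding op_exp_def by (rule someI[where P = "\<lambda>S. c0_semigroup_on (L2_on X) S \<and> generator_on (L2_on X) S = mult_op X h"])
  then show "generator_on (L2_on X) (op_exp (L2_on X) (mult_op X h)) = mult_op X h" by blast
  show "c0_semigroup (L2_on X) (op_exp (L2_on X) (mult_op X h))"
    using * subspace_L2_on closed_L2_on[OF X] by (simp add: c0_semigroup_def)
qed

lemma mult_op_dissipative:
  assumes "(u, w) \<in> mult_op X h"
  shows "inner u w \<le> p * (norm u)\<^sup>2"
proof -
  have "inner u w \<le> (\<integral>x. p * (rep_L2 u x)\<^sup>2 \<partial>lebesgue)"
    unfolding inner_L2_eq
  proof (rule integral_mono_AE)
    show "integrable lebesgue (\<lambda>x. rep_L2 u x * rep_L2 w x)"
      by (rule sq_integrable_mult[OF sq_integrable_rep_L2 sq_integrable_rep_L2])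
    show "integrable lebesgue (\<lambda>x. p * (rep_L2 u x)\<^sup>2)"
      by (intro integrable_mult_right integrable_rep_L2_power2)
    from assms have "AE x in lebesgue. x \<notin> X \<longrightarrow> rep_L2 u x = 0"
      "AE x in lebesgue. x \<in> X \<longrightarrow> rep_L2 w x = h x * rep_L2 u x"
      by (auto simp: mult_op_def L2_on_iff)
    then show "AE x in lebesgue. rep_L2 u x * rep_L2 w x \<le> p * (rep_L2 u x)\<^sup>2"
    proof eventually_elim
      case (elim x)
      show ?case
      proof (cases "x \<in> X")
        case True
        then have "h x * (rep_L2 u x)\<^sup>2 \<le> p * (rep_L2 u x)\<^sup>2" using h_le by (intro mult_right_mono) auto
        then show ?thesis using elim True by (simp add: power2_eq_square mult_ac)
      qed (use elim in simp)
    qed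
  qed
  then show ?thesis by (simp add: norm_L2_power2)
qed

end

text \<open>
  On the range of \<open>A = T\<^bsub>f+p\<^esub>\<close> the asymptotic covariance is \<open>-(\<sigma>\<^sup>2/2) A\<^bsup>-1\<^esup>\<close>: the integral up to
  time \<open>t\<close> is \<open>(\<sigma>\<^sup>2/2) (e\<^bsup>2At\<^esup> w - w)\<close>, and the first term decays.
\<close>

lemma asymptotic_covariance_white_noise:
  assumes h: "dissipative_multiplier X (\<lambda>x. f x + p) p"
    and wz: "(w, z) \<in> mult_op X (\<lambda>x. f x + p)"
  shows "asymptotic_covariance_op X f \<sigma> id p z = (- (\<sigma>\<^sup>2 / 2)) *\<^sub>R w"
proof -
  define E where "E = op_exp (L2_on X) (mult_op X (\<lambda>x. f x + p))"
  have E: "c0_semigroup (L2_on X) E" and gen: "generator_on (L2_on X) E = mult_op X (\<lambda>x. f x + p)"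
    unfolding E_def by (rule dissipative_multiplier.op_exp_mult_op[OF h])+
  have p: "p < 0" by (rule dissipative_multiplier.p_neg[OF h])
  have cov: "covariance_op X f \<sigma> id p t z = \<sigma>\<^sup>2 *\<^sub>R (1/2) *\<^sub>R (E (2 * t) w - w)" if "t \<ge> 0" for t
    unfolding covariance_op_def Let_def E_def[symmetric] id_apply
    using c0_semigroup.has_integral_double_speed[OF E wz[folded gen] that] by (simp add: integral_unique)
  have decay: "norm (E (2 * t) w) \<le> exp (p * (2 * t)) * norm w" if "t \<ge> 0" for t
    using dissipative_semigroup_decay[OF E _ wz[folded gen], of p "2 * t"]
      dissipative_multiplier.mult_op_dissipative[OF h] gen that by simp
  have "((\<lambda>t. E (2 * t) w) \<longlongrightarrow> 0) at_top"
  proof (rule Lim_null_comparison)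
    show "\<forall>\<^sub>F t in at_top. norm (E (2 * t) w) \<le> exp (p * (2 * t)) * norm w"
      using eventually_ge_at_top[of 0] by eventually_elim (rule decay)
    have "((\<lambda>t. exp (p * (2 * t))) \<longlongrightarrow> 0) at_top"
      by (rule filterlim_compose[OF exp_at_bot])
        (intro filterlim_tendsto_neg_mult_at_bot[OF tendsto_const p] filterlim_tendsto_pos_mult_at_top[OF tendsto_const] filterlim_ident, simp)
    then show "((\<lambda>t. exp (p * (2 * t)) * norm w) \<longlongrightarrow> 0) at_top" by (rule tendsto_mult_left_zero)
  qed
  then have "((\<lambda>t. \<sigma>\<^sup>2 *\<^sub>R (1/2) *\<^sub>R (E (2 * t) w - w)) \<longlongrightarrow> \<sigma>\<^sup>2 *\<^sub>R (1/2) *\<^sub>R (0 - w)) at_top"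
    by (intro tendsto_intros)
  moreover have "\<forall>\<^sub>F t in at_top. \<sigma>\<^sup>2 *\<^sub>R (1/2) *\<^sub>R (E (2 * t) w - w) = covariance_op X f \<sigma> id p t z"
    using eventually_ge_at_top[of 0] by eventually_elim (simp add: cov)
  ultimately have "((\<lambda>t. covariance_op X f \<sigma> id p t z) \<longlongrightarrow> \<sigma>\<^sup>2 *\<^sub>R (1/2) *\<^sub>R (0 - w)) at_top"
    by (rule Lim_transform_eventually)
  then show ?thesis
    unfolding asymptotic_covariance_op_def by (subst tendsto_Lim) auto
qed

lemma asymptotic_covariance_indicator:
  assumes h: "dissipative_multiplier X (\<lambda>x. f x + p) p" and S: "S \<in> lmeasurable" "S \<subseteq> X"
  shows "inner (asymptotic_covariance_op X f \<sigma> id p (l2_indicator S)) (l2_indicator S)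
    = \<sigma>\<^sup>2 / 2 * (LINT x:S|lebesgue. 1 / \<bar>f x + p\<bar>)"
proof -
  interpret dissipative_multiplier X "\<lambda>x. f x + p" p by (rule h)
  define \<phi> where "\<phi> x = (if x \<in> X then (1 / (f x + p)) * indicator S x else 0)" for x
  have [measurable]: "S \<in> sets lebesgue" using S by (simp add: fmeasurableD)
  have ind_sq: "sq_integrable (indicator S)"
  proof -
    have "(\<lambda>x. (indicator S x)\<^sup>2) = (indicator S :: real \<Rightarrow> real)" by (auto simp: indicator_def)
    then show ?thesis
      using S by (simp add: sq_integrable_def fmeasurable_def)
  qed
  have \<phi>_sq: "sq_integrable \<phi>"
  proof (rule sq_integrable_bound[OF _ sq_integrable_scale[OF ind_sq, of "1 / p"]])
    show "\<phi> \<in> borel_measurable lebesgue"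
      unfolding \<phi>_def[abs_def] by (rule measurable_mult[where F = "\<lambda>y. 1 / y"]) measurable
    have "1 / \<bar>f x + p\<bar> \<le> 1 / \<bar>p\<bar>" if "x \<in> X" for x
      using h_le[OF that] p_neg by (intro frac_le) auto
    then show "AE x in lebesgue. \<bar>\<phi> x\<bar> \<le> \<bar>1 / p * indicator S x\<bar>"
      by (auto simp: \<phi>_def abs_mult indicator_def)
  qed
  define w where "w = abs_L2 \<phi>"
  have "(w, l2_indicator S) \<in> mult_op X (\<lambda>x. f x + p)"
    unfolding mult_op_def L2_on_iff w_def l2_indicator_def
  proof (safe; use rep_abs_L2_AE[OF \<phi>_sq] rep_abs_L2_AE[OF ind_sq] in eventually_elim)
    fix x assume "rep_L2 (abs_L2 \<phi>) x = \<phi> x" "rep_L2 (abs_L2 (indicator S)) x = indicator S x"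
    then show "x \<notin> X \<longrightarrow> rep_L2 (abs_L2 \<phi>) x = 0"
      and "x \<notin> X \<longrightarrow> rep_L2 (abs_L2 (indicator S)) x = 0"
      and "x \<in> X \<longrightarrow> rep_L2 (abs_L2 (indicator S)) x = (f x + p) * rep_L2 (abs_L2 \<phi>) x"
      using S(2) h_neg[of x] by (auto simp: \<phi>_def indicator_def)
  qed
  from asymptotic_covariance_white_noise[OF h this]
  have "inner (asymptotic_covariance_op X f \<sigma> id p (l2_indicator S)) (l2_indicator S)
      = - (\<sigma>\<^sup>2 / 2) * (\<integral>x. \<phi> x * indicator S x \<partial>lebesgue)"
    unfolding w_def l2_indicator_def by (simp add: inner_abs_L2[OF \<phi>_sq ind_sq])
  also have "(\<lambda>x. \<phi> x * indicator S x) = (\<lambda>x. - (indicator S x *\<^sub>R (1 / \<bar>f x + p\<bar>)))"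
  proof
    fix x
    show "\<phi> x * indicator S x = - (indicator S x *\<^sub>R (1 / \<bar>f x + p\<bar>))"
    proof (cases "x \<in> S")
      case True
      then have "\<bar>f x + p\<bar> = - (f x + p)" using S(2) h_neg[of x] by (intro abs_of_neg) auto
      then have "- (1 / \<bar>f x + p\<bar>) = 1 / (f x + p)" by (simp only: minus_divide_right minus_minus)
      then show ?thesis using True S(2) by (auto simp: \<phi>_def)
    qed simp
  qed
  finally show ?thesis by (simp add: set_lebesgue_integral_def id_def)
qed

section \<open>Asymptotics of the cusp integral\<close>

text \<open>
  Used with \<open>x = 1/q\<close> and with the upper end of an interval of integration.
\<close>

lemma bounded_mono_tendsto_at_top:
  fixes F :: "real \<Rightarrow> real"
  assumes mono: "\<And>x y. 0 < x \<Longrightarrow> x \<le> y \<Longrightarrow> F x \<le> F y" and pos: "\<And>x. 0 < x \<Longrightarrow> 0 < F x"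
    and bound: "\<And>x. 0 < x \<Longrightarrow> F x \<le> B"
  shows "\<exists>L>0. (F \<longlongrightarrow> L) at_top"
proof (intro exI conjI)
  define L where "L = Sup (F ` {0<..})"
  have bdd: "bdd_above (F ` {0<..})" using bound by (auto intro!: bdd_aboveI)
  have le: "F x \<le> L" if "x > 0" for x
    unfolding L_def using bdd that by (intro cSup_upper) auto
  show "L > 0" using pos[of 1] le[of 1] by simp
  show "(F \<longlongrightarrow> L) at_top"
  proof (rule order_tendstoI)
    fix a assume "a < L"
    then obtain x where x: "x > 0" "a < F x"
      using bdd by (auto simp: L_def less_cSup_iff)
    show "\<forall>\<^sub>F y in at_top. a < F y"
      using eventually_ge_at_top[of x] by eventually_elim (use mono[OF x(1)] x(2) in force)
  next
    fix a assume "L < a"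
    show "\<forall>\<^sub>F y in at_top. F y < a"
      using eventually_gt_at_top[of 0] by eventually_elim (use le \<open>L < a\<close> in force)
  qed
qed

definition cusp_integral :: "real \<Rightarrow> real \<Rightarrow> real \<Rightarrow> real" where
  "cusp_integral \<alpha> \<epsilon> q = integral {0..\<epsilon>} (\<lambda>x. 1 / (x powr \<alpha> + q))"

lemma continuous_on_J_integrand:
  assumes "\<alpha> > 0" "q > 0"
  shows "continuous_on {0..r} (\<lambda>x::real. 1 / (x powr \<alpha> + q))"
proof -
  have "x powr \<alpha> + q \<noteq> 0" for x using assms(2) powr_ge_zero[of x \<alpha>] by linarith
  then show ?thesis using assms by (intro continuous_intros continuous_on_powr') auto
qed

lemma cusp_integral_integrable:
  assumes "\<alpha> > 0" "q > 0"
  shows "(\<lambda>x::real. 1 / (x powr \<alpha> + q)) integrable_on {0..r}"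
  using continuous_on_J_integrand[OF assms] by (rule integrable_continuous_real)

lemma cusp_integral_pos:
  assumes "\<alpha> > 0" "\<epsilon> > 0" "q > 0"
  shows "cusp_integral \<alpha> \<epsilon> q > 0"
proof -
  have "0 < \<epsilon> * (1 / (\<epsilon> powr \<alpha> + q))"
    using assms powr_ge_zero[of \<epsilon> \<alpha>] by (intro mult_pos_pos divide_pos_pos) linarith+
  also have "\<dots> = integral {0..\<epsilon>} (\<lambda>x. 1 / (\<epsilon> powr \<alpha> + q))" using assms by simp
  also have "\<dots> \<le> cusp_integral \<alpha> \<epsilon> q"
    unfolding cusp_integral_def
  proof (rule integral_le[OF _ cusp_integral_integrable[OF assms(1,3)]])
    fix x assume "x \<in> {0..\<epsilon>}"
    then have "x powr \<alpha> \<le> \<epsilon> powr \<alpha>" using assms by (intro powr_mono2) auto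
    then show "1 / (\<epsilon> powr \<alpha> + q) \<le> 1 / (x powr \<alpha> + q)"
      using assms powr_ge_zero[of x \<alpha>] by (intro frac_le) linarith+
  qed auto
  finally show ?thesis .
qed

lemma cusp_integral_antimono:
  assumes "\<alpha> > 0" "0 < q" "q \<le> q'"
  shows "cusp_integral \<alpha> \<epsilon> q' \<le> cusp_integral \<alpha> \<epsilon> q"
  unfolding cusp_integral_def
proof (intro integral_le cusp_integral_integrable)
  fix x assume "x \<in> {0..\<epsilon>}"
  show "1 / (x powr \<alpha> + q') \<le> 1 / (x powr \<alpha> + q)"
    using assms powr_ge_zero[of x \<alpha>] by (intro frac_le) linarith+
qed (use assms in auto)

text \<open>
  The bound is the integral of \<open>x\<^bsup>-\<alpha>\<^esup>\<close>.  The point \<open>0\<close> is removed for the comparison, since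
  \<open>0 powr (- \<alpha>) = 0\<close> is smaller than \<open>1/q\<close>.
\<close>

lemma cusp_integral_tendsto_of_lt_1:
  assumes "0 < \<alpha>" "\<alpha> < 1" "\<epsilon> > 0"
  shows "\<exists>L>0. (cusp_integral \<alpha> \<epsilon> \<longlongrightarrow> L) (at_right 0)"
proof -
  have hi: "((\<lambda>x. x powr (- \<alpha>)) has_integral (\<epsilon> powr (- \<alpha> + 1) / (- \<alpha> + 1))) {0..\<epsilon>}"
    using has_integral_powr_from_0[of "- \<alpha>" \<epsilon>] assms by simp
  have "cusp_integral \<alpha> \<epsilon> q \<le> \<epsilon> powr (- \<alpha> + 1) / (- \<alpha> + 1)" if q: "q > 0" for q
  proof -
    have "cusp_integral \<alpha> \<epsilon> q = integral {0<..\<epsilon>} (\<lambda>x. 1 / (x powr \<alpha> + q))"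
      unfolding cusp_integral_def by (rule integral_spike_set) (rule negligible_subset[of "{0::real}"]; auto)+
    also have "\<dots> \<le> integral {0<..\<epsilon>} (\<lambda>x. x powr (- \<alpha>))"
    proof (rule integral_le)
      show "(\<lambda>x. 1 / (x powr \<alpha> + q)) integrable_on {0<..\<epsilon>}"
        using cusp_integral_integrable[OF assms(1) q, of \<epsilon>]
        by (rule integrable_spike_set) (rule negligible_subset[of "{0::real}"]; auto)+
      show "(\<lambda>x. x powr (- \<alpha>)) integrable_on {0<..\<epsilon>}"
        using has_integral_integrable[OF hi]
        by (rule integrable_spike_set) (rule negligible_subset[of "{0::real}"]; auto)+
      fix x assume x: "x \<in> {0<..\<epsilon>}"
      have "1 / (x powr \<alpha> + q) \<le> 1 / x powr \<alpha>" using x q by (intro frac_le) auto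
      then show "1 / (x powr \<alpha> + q) \<le> x powr (- \<alpha>)" by (simp add: powr_minus inverse_eq_divide)
    qed
    also have "\<dots> = integral {0..\<epsilon>} (\<lambda>x. x powr (- \<alpha>))"
      by (rule integral_spike_set) (rule negligible_subset[of "{0::real}"]; auto)+
    also have "\<dots> = \<epsilon> powr (- \<alpha> + 1) / (- \<alpha> + 1)" using hi by (rule integral_unique)
    finally show ?thesis .
  qed
  then have "\<exists>L>0. ((\<lambda>R. cusp_integral \<alpha> \<epsilon> (inverse R)) \<longlongrightarrow> L) at_top"
    using assms
    by (intro bounded_mono_tendsto_at_top[where B = "\<epsilon> powr (- \<alpha> + 1) / (- \<alpha> + 1)"] cusp_integral_antimono cusp_integral_pos) auto
  then show ?thesis by (simp add: filterlim_at_right_to_top)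
qed

lemma cusp_integral_1:
  assumes "\<epsilon> > 0" "q > 0"
  shows "cusp_integral 1 \<epsilon> q = ln (\<epsilon> + q) - ln q"
proof -
  have "((\<lambda>x. 1 / (x + q)) has_integral (ln (\<epsilon> + q) - ln (0 + q))) {0..\<epsilon>}"
    using assms
    by (intro fundamental_theorem_of_calculus)
      (auto intro!: derivative_eq_intros simp: has_real_derivative_iff_has_vector_derivative[symmetric])
  then have "integral {0..\<epsilon>} (\<lambda>x. 1 / (x + q)) = ln (\<epsilon> + q) - ln q"
    by (simp add: integral_unique)
  moreover have "cusp_integral 1 \<epsilon> q = integral {0..\<epsilon>} (\<lambda>x. 1 / (x + q))"
    unfolding cusp_integral_def by (rule integral_cong) simp
  ultimately show ?thesis by simp
qed

lemma cusp_integral_1_tendsto: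
  assumes "\<epsilon> > 0"
  shows "((\<lambda>q. cusp_integral 1 \<epsilon> q / - ln q) \<longlongrightarrow> 1) (at_right 0)"
proof -
  have lim: "((\<lambda>q. 1 - ln (\<epsilon> + q) / ln q) \<longlongrightarrow> 1 - 0) (at_right 0)"
  proof (intro tendsto_intros)
    have num: "((\<lambda>q. ln (\<epsilon> + q)) \<longlongrightarrow> ln (\<epsilon> + 0)) (at_right 0)"
      using assms by (intro tendsto_intros) auto
    show "((\<lambda>q. ln (\<epsilon> + q) / ln q) \<longlongrightarrow> 0) (at_right 0)"
      by (rule tendsto_divide_0[OF num filterlim_mono[OF ln_at_0 at_bot_le_at_infinity order_refl]])
  qed
  have "\<forall>\<^sub>F q in at_right (0::real). 0 < q \<and> q < 1"
    unfolding eventually_at_right_field by (rule exI[of _ 1]) auto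
  then have "\<forall>\<^sub>F q in at_right 0. 1 - ln (\<epsilon> + q) / ln q = cusp_integral 1 \<epsilon> q / - ln q"
  proof eventually_elim
    case (elim q)
    then have "ln q \<noteq> 0" by simp
    then show ?case using elim cusp_integral_1[OF assms, of q] by (simp add: diff_divide_distrib)
  qed
  with lim show ?thesis by (auto elim: Lim_transform_eventually)
qed

text \<open>
  The substitution \<open>y = m x\<close> with \<open>m = q\<^bsup>-1/\<alpha>\<^esup>\<close>, for which \<open>x\<^sup>\<alpha> + q = q (y\<^sup>\<alpha> + 1)\<close>.
\<close>

lemma cusp_integral_scaling:
  assumes "\<alpha> > 0" "\<epsilon> > 0" "q > 0"
  shows "cusp_integral \<alpha> \<epsilon> q = q powr (- 1 + 1 / \<alpha>) * cusp_integral \<alpha> (\<epsilon> * q powr (- 1 / \<alpha>)) 1"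
proof -
  define m where "m = q powr (- 1 / \<alpha>)"
  have m: "m > 0" using assms by (simp add: m_def)
  have ma: "m powr \<alpha> = 1 / q"
  proof -
    have "m powr \<alpha> = q powr (- 1 / \<alpha> * \<alpha>)" unfolding m_def by (rule powr_powr)
    then show ?thesis using assms by (simp add: powr_minus_divide)
  qed
  have "((\<lambda>x. 1 / (x powr \<alpha> + 1)) has_integral cusp_integral \<alpha> (\<epsilon> * m) 1) {0..\<epsilon> * m}"
    unfolding cusp_integral_def by (rule integrable_integral[OF cusp_integral_integrable]) (use assms in auto)
  then have "((\<lambda>x. 1 / ((m * x) powr \<alpha> + 1)) has_integral (1 / m) *\<^sub>R cusp_integral \<alpha> (\<epsilon> * m) 1) ((\<lambda>x. x / m) ` {0..\<epsilon> * m})"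
    using has_integral_stretch_real[of "\<lambda>x. 1 / (x powr \<alpha> + 1)" _ 0 "\<epsilon> * m" m] m by (simp add: inverse_eq_divide)
  moreover have "(\<lambda>x. x / m) ` {0..\<epsilon> * m} = {0..\<epsilon>}"
    using m assms by (simp add: image_divide_atLeastAtMost)
  ultimately have 1: "((\<lambda>x. 1 / ((m * x) powr \<alpha> + 1)) has_integral (1 / m) * cusp_integral \<alpha> (\<epsilon> * m) 1) {0..\<epsilon>}" by simp
  have "((\<lambda>x. 1 / (x powr \<alpha> + q)) has_integral (1 / q) * ((1 / m) * cusp_integral \<alpha> (\<epsilon> * m) 1)) {0..\<epsilon>}"
  proof (rule has_integral_eq[OF _ has_integral_mult_right[OF 1]])
    fix x assume "x \<in> {0..\<epsilon>}"
    then have "(m * x) powr \<alpha> = x powr \<alpha> / q" using m ma by (simp add: powr_mult)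
    then show "1 / q * (1 / ((m * x) powr \<alpha> + 1)) = 1 / (x powr \<alpha> + q)"
      using assms by (simp add: field_simps)
  qed
  then have "cusp_integral \<alpha> \<epsilon> q = (1 / q) * (1 / m) * cusp_integral \<alpha> (\<epsilon> * m) 1"
    by (simp add: cusp_integral_def integral_unique)
  also have "(1 / q) * (1 / m) = q powr (- 1) * q powr (1 / \<alpha>)"
    using assms by (simp add: m_def powr_minus inverse_eq_divide)
  also have "\<dots> = q powr (- 1 + 1 / \<alpha>)" by (rule powr_add[symmetric])
  finally show ?thesis by (simp add: m_def)
qed

text \<open>
  The integrand is at most \<open>1\<close> on \<open>[0, 1]\<close> and at most \<open>x\<^bsup>-\<alpha>\<^esup>\<close> beyond.
\<close>

lemma cusp_integral_le_of_gt_1: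
  assumes "\<alpha> > 1" "r > 0"
  shows "cusp_integral \<alpha> r 1 \<le> 1 + 1 / (\<alpha> - 1)"
proof -
  have mono: "cusp_integral \<alpha> r 1 \<le> cusp_integral \<alpha> (max r 1) 1"
    unfolding cusp_integral_def by (rule integral_subset_le) (use assms cusp_integral_integrable[of \<alpha> 1] in auto)
  define R where "R = max r 1"
  have R: "R \<ge> 1" by (simp add: R_def)
  have "cusp_integral \<alpha> R 1 = integral {0..1} (\<lambda>x. 1 / (x powr \<alpha> + 1)) + integral {1..R} (\<lambda>x. 1 / (x powr \<alpha> + 1))"
    unfolding cusp_integral_def by (rule Henstock_Kurzweil_Integration.integral_combine[symmetric])
      (use R assms cusp_integral_integrable[of \<alpha> 1] in auto)
  moreover have "integral {0..1} (\<lambda>x. 1 / (x powr \<alpha> + 1)) \<le> integral {0..1} (\<lambda>x::real. 1)"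
  proof (rule integral_le)
    show "1 / (x powr \<alpha> + 1) \<le> 1" for x
      using powr_ge_zero[of x \<alpha>] by (subst divide_le_eq_1_pos) linarith+
  qed (use assms cusp_integral_integrable[of \<alpha> 1] in auto)
  moreover have "integral {1..R} (\<lambda>x. 1 / (x powr \<alpha> + 1)) \<le> 1 / (\<alpha> - 1)"
  proof -
    have der: "((\<lambda>x. x powr (- \<alpha>)) has_integral (- (R powr (1 - \<alpha>)) / (\<alpha> - 1) - - (1 powr (1 - \<alpha>)) / (\<alpha> - 1))) {1..R}"
    proof (rule fundamental_theorem_of_calculus[OF R])
      fix x assume "x \<in> {1..R}"
      then have "((\<lambda>x. x powr (1 - \<alpha>)) has_real_derivative (1 - \<alpha>) * x powr (- \<alpha>)) (at x within {1..R})"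
        using has_real_derivative_powr[of x "1 - \<alpha>"] by (auto intro: has_field_derivative_at_within)
      from DERIV_cmult[OF this, of "- 1 / (\<alpha> - 1)"]
      have "((\<lambda>x. - (x powr (1 - \<alpha>)) / (\<alpha> - 1)) has_real_derivative
          - 1 / (\<alpha> - 1) * (1 - \<alpha>) * x powr (- \<alpha>)) (at x within {1..R})" by (simp add: mult.assoc)
      also have "- 1 / (\<alpha> - 1) * (1 - \<alpha>) = 1" using assms by (simp add: divide_simps)
      finally have "((\<lambda>x. - (x powr (1 - \<alpha>)) / (\<alpha> - 1)) has_real_derivative x powr (- \<alpha>)) (at x within {1..R})" by simp
      then show "((\<lambda>x. - (x powr (1 - \<alpha>)) / (\<alpha> - 1)) has_vector_derivative x powr (- \<alpha>)) (at x within {1..R})"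
        by (simp add: has_real_derivative_iff_has_vector_derivative)
    qed
    have "integral {1..R} (\<lambda>x. 1 / (x powr \<alpha> + 1)) \<le> integral {1..R} (\<lambda>x. x powr (- \<alpha>))"
    proof (rule integral_le)
      show "(\<lambda>x. 1 / (x powr \<alpha> + 1)) integrable_on {1..R}"
        by (rule integrable_on_subinterval[OF cusp_integral_integrable[of \<alpha> 1 R]]) (use assms in auto)
      show "(\<lambda>x. x powr (- \<alpha>)) integrable_on {1..R}" using der by (rule has_integral_integrable)
      fix x assume "x \<in> {1..R}"
      then have "1 / (x powr \<alpha> + 1) \<le> 1 / x powr \<alpha>" by (intro frac_le) auto
      then show "1 / (x powr \<alpha> + 1) \<le> x powr (- \<alpha>)" by (simp add: powr_minus inverse_eq_divide)
    qed
    also have "\<dots> = 1 / (\<alpha> - 1) - R powr (1 - \<alpha>) / (\<alpha> - 1)" using integral_unique[OF der] by simp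
    also have "\<dots> \<le> 1 / (\<alpha> - 1)" using assms by simp
    finally show ?thesis .
  qed
  ultimately show ?thesis using mono by (simp add: R_def)
qed

lemma cusp_integral_tendsto_of_gt_1:
  assumes "\<alpha> > 1" "\<epsilon> > 0"
  shows "\<exists>L>0. ((\<lambda>q. cusp_integral \<alpha> \<epsilon> q / q powr (- 1 + 1 / \<alpha>)) \<longlongrightarrow> L) (at_right 0)"
proof -
  have "\<exists>L>0. ((\<lambda>r. cusp_integral \<alpha> r 1) \<longlongrightarrow> L) at_top"
  proof (rule bounded_mono_tendsto_at_top)
    show "cusp_integral \<alpha> r 1 \<le> cusp_integral \<alpha> r' 1" if "0 < r" "r \<le> r'" for r r'
      unfolding cusp_integral_def by (rule integral_subset_le) (use that assms cusp_integral_integrable[of \<alpha> 1] in auto)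
  qed (use assms cusp_integral_le_of_gt_1 cusp_integral_pos in auto)
  then obtain L where L: "L > 0" "((\<lambda>r. cusp_integral \<alpha> r 1) \<longlongrightarrow> L) at_top" by blast
  have "filterlim (\<lambda>q. exp (1 / \<alpha> * - ln q)) at_top (at_right 0)"
    by (rule filterlim_compose[OF exp_at_top], rule filterlim_tendsto_pos_mult_at_top[OF tendsto_const])
      (use assms ln_at_0 in \<open>auto simp: filterlim_uminus_at_top\<close>)
  then have "filterlim (\<lambda>q. \<epsilon> * exp (1 / \<alpha> * - ln q)) at_top (at_right 0)"
    by (rule filterlim_tendsto_pos_mult_at_top[OF tendsto_const assms(2)])
  then have "((\<lambda>q. cusp_integral \<alpha> (\<epsilon> * exp (1 / \<alpha> * - ln q)) 1) \<longlongrightarrow> L) (at_right 0)"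
    by (rule filterlim_compose[OF L(2)])
  moreover have "\<forall>\<^sub>F q in at_right 0. cusp_integral \<alpha> (\<epsilon> * exp (1 / \<alpha> * - ln q)) 1 = cusp_integral \<alpha> \<epsilon> q / q powr (- 1 + 1 / \<alpha>)"
    using eventually_at_right_less[of "0::real"]
  proof eventually_elim
    case (elim q)
    have "exp (1 / \<alpha> * - ln q) = q powr (- 1 / \<alpha>)"
      using elim by (simp add: powr_def)
    then show ?case using cusp_integral_scaling[of \<alpha> \<epsilon> q] assms elim by simp
  qed
  ultimately have "((\<lambda>q. cusp_integral \<alpha> \<epsilon> q / q powr (- 1 + 1 / \<alpha>)) \<longlongrightarrow> L) (at_right 0)"
    by (rule Lim_transform_eventually)
  with L(1) show ?thesis by blast
qed

text \<open>
  One positive limit is enough, since the other quotient is the inverse.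
\<close>

lemma is_Theta_at_0_minusI:
  assumes "\<And>p. p < 0 \<Longrightarrow> b1 p > 0" "\<forall>\<^sub>F p in at_left 0. b2 p > 0"
    and "L > 0" "((\<lambda>p. b1 p / b2 p) \<longlongrightarrow> L) (at_left 0)"
  shows "is_Theta_at_0_minus b1 b2"
  unfolding is_Theta_at_0_minus_def
proof (intro conjI)
  show "\<forall>\<^sub>F p in at_left 0. b1 p > 0"
    using assms(1) by (auto simp: eventually_at_left_field intro: exI[of _ "-1"])
  have "((\<lambda>p. inverse (b1 p / b2 p)) \<longlongrightarrow> inverse L) (at_left 0)"
    using assms(3,4) by (intro tendsto_inverse) auto
  then show "\<exists>L>0. ((\<lambda>p. b2 p / b1 p) \<longlongrightarrow> L) (at_left 0)"
    using assms(3) by (auto intro!: exI[of _ "inverse L"])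
qed (use assms in auto)

section \<open>The three scaling regimes\<close>

theorem theorem3p1:
  fixes X N :: "real set" and f :: "real \<Rightarrow> real" and \<alpha> \<sigma> \<epsilon> :: real
    and Q :: "L2 \<Rightarrow> L2" and V :: "real \<Rightarrow> L2 \<Rightarrow> L2" and g :: L2
  assumes "connected X" and "interior X \<noteq> {}"
    and "\<alpha> > 0" and "\<sigma> > 0" and "\<epsilon> > 0"
    and "f \<in> borel_measurable (lebesgue_on X)"
    and "0 \<in> X" and "f 0 = 0"
    and "\<forall>x \<in> X - {0}. f x < 0"
    and "\<forall>p<0. integrable (lebesgue_on X) (\<lambda>x. 1 / \<bar>f x + p\<bar>)"
    and "0 \<in> interior N" and "{0..\<epsilon>} \<subseteq> N" and "{0..\<epsilon>} \<subseteq> X"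
    and "\<forall>x \<in> X \<inter> N. f x = - (\<bar>x\<bar> powr \<alpha>)"
    and "Q = id"
    and "V = asymptotic_covariance_op X f \<sigma> Q"
    and "g = l2_indicator {0..\<epsilon>}"
  shows "(0 < \<alpha> \<and> \<alpha> < 1 \<longrightarrow> is_Theta_at_0_minus (\<lambda>p. inner (V p g) g) (\<lambda>p. 1)) \<and>
    (\<alpha> = 1 \<longrightarrow> is_Theta_at_0_minus (\<lambda>p. inner (V p g) g) (\<lambda>p. - ln (- p))) \<and>
    (\<alpha> > 1 \<longrightarrow> is_Theta_at_0_minus (\<lambda>p. inner (V p g) g) (\<lambda>p. (- p) powr (- 1 + 1 / \<alpha>))) \<and>
    ((\<lambda>a::real. - 1 + 1 / a) \<longlongrightarrow> - 1) at_top \<and>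
    (\<forall>p::real. p < 0 \<longrightarrow> ((\<lambda>a::real. (- p) powr (- 1 + 1 / a)) \<longlongrightarrow> (- p) powr (- 1)) at_top)"
proof -
  have X: "X \<in> sets lebesgue"
    using assms(1) by (intro sets_completionI_sets) (simp add: real_interval_borel_measurable is_interval_connected_1)
  have f_le: "f x \<le> 0" if "x \<in> X" for x
    using assms(8,9) that by (cases "x = 0") (auto intro: less_imp_le)
  have V_eq: "inner (V p g) g = \<sigma>\<^sup>2 / 2 * cusp_integral \<alpha> \<epsilon> (- p)" if p: "p < 0" for p
  proof -
    have "dissipative_multiplier X (\<lambda>x. f x + p) p"
      using X assms(6) f_le p by unfold_locales auto
    then have "inner (V p g) g = \<sigma>\<^sup>2 / 2 * (LINT x:{0..\<epsilon>}|lebesgue. 1 / \<bar>f x + p\<bar>)"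
      unfolding assms(15-17) using assms(13) by (intro asymptotic_covariance_indicator) auto
    also have "(LINT x:{0..\<epsilon>}|lebesgue. 1 / \<bar>f x + p\<bar>) = (LINT x:{0..\<epsilon>}|lebesgue. 1 / (x powr \<alpha> + - p))"
    proof (rule set_lebesgue_integral_cong, simp, intro allI impI)
      fix x assume x: "x \<in> {0..\<epsilon>}"
      then have "x \<in> X \<inter> N" using assms(12,13) by blast
      then have "f x = - (x powr \<alpha>)" using assms(14) x by simp
      then have "\<bar>f x + p\<bar> = x powr \<alpha> + - p" using p powr_ge_zero[of x \<alpha>] by linarith
      then show "1 / \<bar>f x + p\<bar> = 1 / (x powr \<alpha> + - p)" by (rule arg_cong)
    qed
    also have "\<dots> = cusp_integral \<alpha> \<epsilon> (- p)"
      unfolding cusp_integral_def using assms(3) p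
      by (intro set_lebesgue_integral_eq_integral(2) absolutely_integrable_continuous_real
          continuous_on_J_integrand) auto
    finally show ?thesis .
  qed
  have Theta: "is_Theta_at_0_minus (\<lambda>p. inner (V p g) g) (\<lambda>p. b (- p))"
    if b: "\<forall>\<^sub>F q in at_right 0. b q > 0" and L: "L > 0" "((\<lambda>q. cusp_integral \<alpha> \<epsilon> q / b q) \<longlongrightarrow> L) (at_right 0)" for b L
  proof (rule is_Theta_at_0_minusI)
    show "inner (V p g) g > 0" if "p < 0" for p
      using that assms(3-5) by (simp add: V_eq cusp_integral_pos)
    show "\<forall>\<^sub>F p in at_left 0. b (- p) > 0"
      using b by (simp add: eventually_at_left_to_right)
    show "\<sigma>\<^sup>2 / 2 * L > 0" using assms(4) L(1) by simp
    have "((\<lambda>p. cusp_integral \<alpha> \<epsilon> (- p) / b (- p)) \<longlongrightarrow> L) (at_left 0)"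
      using L(2) by (simp add: filterlim_at_left_to_right)
    then have "((\<lambda>p. \<sigma>\<^sup>2 / 2 * (cusp_integral \<alpha> \<epsilon> (- p) / b (- p))) \<longlongrightarrow> \<sigma>\<^sup>2 / 2 * L) (at_left 0)"
      by (intro tendsto_intros)
    moreover have "\<forall>\<^sub>F p in at_left 0. \<sigma>\<^sup>2 / 2 * (cusp_integral \<alpha> \<epsilon> (- p) / b (- p)) = inner (V p g) g / b (- p)"
      by (auto simp: eventually_at_left_field V_eq intro: exI[of _ "-1"])
    ultimately show "((\<lambda>p. inner (V p g) g / b (- p)) \<longlongrightarrow> \<sigma>\<^sup>2 / 2 * L) (at_left 0)"
      by (rule Lim_transform_eventually)
  qed
  have i: "is_Theta_at_0_minus (\<lambda>p. inner (V p g) g) (\<lambda>p. 1)" if "\<alpha> < 1"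
    using cusp_integral_tendsto_of_lt_1[OF assms(3) that assms(5)] Theta[of "\<lambda>_. 1"] by auto
  have ii: "is_Theta_at_0_minus (\<lambda>p. inner (V p g) g) (\<lambda>p. - ln (- p))" if "\<alpha> = 1"
  proof (rule Theta)
    show "((\<lambda>q. cusp_integral \<alpha> \<epsilon> q / - ln q) \<longlongrightarrow> 1) (at_right 0)"
      using cusp_integral_1_tendsto[OF assms(5)] that by simp
    show "\<forall>\<^sub>F q in at_right 0. 0 < - ln (q::real)"
      by (auto simp: eventually_at_right_field intro: exI[of _ 1])
  qed simp
  have iii: "is_Theta_at_0_minus (\<lambda>p. inner (V p g) g) (\<lambda>p. (- p) powr (- 1 + 1 / \<alpha>))" if a: "\<alpha> > 1"
  proof -
    obtain L where L: "L > 0" "((\<lambda>q. cusp_integral \<alpha> \<epsilon> q / q powr (- 1 + 1 / \<alpha>)) \<longlongrightarrow> L) (at_right 0)"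
      using cusp_integral_tendsto_of_gt_1[OF a assms(5)] by blast
    show ?thesis
      by (rule Theta[OF _ L]) (auto simp: eventually_at_right_field intro: exI[of _ 1])
  qed
  have "((\<lambda>a::real. - 1 + 1 / a) \<longlongrightarrow> - 1 + 0) at_top"
    by (rule tendsto_add[OF tendsto_const tendsto_divide_0[OF tendsto_const
          filterlim_mono[OF filterlim_ident at_top_le_at_infinity order_refl]]])
  then have exponent: "((\<lambda>a::real. - 1 + 1 / a) \<longlongrightarrow> - 1) at_top" by simp
  have "((\<lambda>a::real. (- p) powr (- 1 + 1 / a)) \<longlongrightarrow> (- p) powr (- 1)) at_top" if "p < 0" for p :: real
    using that by (intro tendsto_powr tendsto_const exponent) auto
  with i ii iii exponent show ?thesis by blast
qed

end
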